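(* Suppose that for every $\ell\in\mathbb Z$ each constriction curve (connected component of $Constr_\ell$) is bijectively analytically projected onto the semiaxis $(\mathbb R_+)_a$ by $(a,s)\mapsto a$. Then each constriction curve lands at some $\beta_{\ell,k}$, i.e., for every $\ell\in\mathbb Z$ each connected component of $Constr_\ell$ coincides with some $\mathcal C_{\ell,k}$, $k\in\mathbb N$.
   Context: $\mathbb R_+=(0,+\infty)$. For $\ell\in\mathbb Z$ let $h_{\ell,a,s}:S^1\to S^1$, $S^1=\mathbb R/2\pi\mathbb Z$, be the time $2\pi$ flow map (from $\tau=0$ to $\tau=2\pi$) of the equation $\frac{d\theta}{d\tau}=a\cos\theta+\ell+s\cos\tau$. The constriction submanifold is $Constr_\ell=\{(a,s)\in\mathbb R_+^2:\ h_{\ell,a,s}=Id\}$; it is known to be a one-dimensional analytic submanifold, closed in $\mathbb R_+^2$. (Its points correspond to the constrictions, i.e. the separation points with $A\neq0$ between consecutive domains, of the phase-lock areas with rotation number $\ell$ of the overdamped Josephson junction model $\frac{d\phi}{dt}=-\sin\phi+B+A\cos\omega t$, with $a=\omega^{-1}$, $s=A/\omega$, $\ell=B/\omega$.) For $k\in\mathbb N$ let $\beta_{\ell,k}=(0,s_{\ell,k})$, where $s_{\ell,k}$ is the $k$-th positive zero of the Bessel function $J_\ell$; $\mathcal C_{\ell,k}$ denotes the unique connected component of $Constr_\ell$ whose closure in $\mathbb R^2$ contains $\beta_{\ell,k}$. *)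

theory Defs
  imports "HOL-Analysis.Analysis"
begin

text \<open>
  \<open>S\<^sup>1 = \<real>/2\<pi>\<int>\<close> is identified with the unit circle of \<open>\<complex>\<close> by \<open>\<theta> \<mapsto> cis \<theta>\<close>; solutions
  of the equation on \<open>S\<^sup>1\<close> are represented by their real-valued lifts.
\<close>

definition josephson_solution :: "int \<Rightarrow> real \<Rightarrow> real \<Rightarrow> (real \<Rightarrow> real) \<Rightarrow> bool" where
  "josephson_solution l a s \<theta> \<longleftrightarrow>
     (\<forall>\<tau>\<in>{0..2*pi}. (\<theta> has_real_derivative
        a * cos (\<theta> \<tau>) + of_int l + s * cos \<tau>) (at \<tau> within {0..2*pi}))"

text \<open>The description below is proper for every \<open>z\<close> on the unit circle, the equation being
  globally Lipschitz in \<open>\<theta>\<close> and \<open>2\<pi>\<close>-periodic in \<open>\<theta>\<close>.\<close>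

definition flow_map :: "int \<Rightarrow> real \<Rightarrow> real \<Rightarrow> complex \<Rightarrow> complex" where
  "flow_map l a s z =
     (THE w. \<exists>\<theta>. josephson_solution l a s \<theta> \<and> cis (\<theta> 0) = z \<and> cis (\<theta> (2*pi)) = w)"

definition Constr :: "int \<Rightarrow> (real \<times> real) set" where
  "Constr l = {(a, s). a > 0 \<and> s > 0 \<and> (\<forall>z\<in>sphere 0 1. flow_map l a s z = z)}"

text \<open>Power series of the Bessel function of the first kind of integer order. For negative
  \<open>l\<close> the terms with \<open>m + l < 0\<close> vanish, since \<open>rGamma = 1 / \<Gamma>\<close> is zero at the poles of \<open>\<Gamma>\<close>.\<close>

definition Bessel_J :: "int \<Rightarrow> real \<Rightarrow> real" where
  "Bessel_J l x =
     (\<Sum>m. (-1) ^ m / fact m * rGamma (of_int (int m + l + 1)) * (x / 2) powi (2 * int m + l))"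

text \<open>The \<open>k\<close>-th positive zero, counted from \<open>k = 1\<close>.\<close>

definition Bessel_zero :: "int \<Rightarrow> nat \<Rightarrow> real" where
  "Bessel_zero l k =
     (THE x. x > 0 \<and> Bessel_J l x = 0 \<and> card {y. 0 < y \<and> y \<le> x \<and> Bessel_J l y = 0} = k)"

definition beta_pt :: "int \<Rightarrow> nat \<Rightarrow> real \<times> real" where
  "beta_pt l k = (0, Bessel_zero l k)"

definition constr_curve :: "int \<Rightarrow> nat \<Rightarrow> (real \<times> real) set" where
  "constr_curve l k = (THE C. C \<in> components (Constr l) \<and> beta_pt l k \<in> closure C)"

definition real_analytic_on :: "(real \<Rightarrow> real) \<Rightarrow> real set \<Rightarrow> bool" where
  "real_analytic_on f S \<longleftrightarrow>
     (\<forall>x\<in>S. \<exists>c :: nat \<Rightarrow> real. \<exists>r>0. \<forall>y. \<bar>y - x\<bar> < r \<longrightarrow> (\<lambda>n. c n * (y - x) ^ n) sums f y)"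

text \<open>The projection \<open>(a, s) \<mapsto> a\<close> is an analytic isomorphism of \<open>C\<close> onto \<open>{0<..}\<close>. As the
  restriction of a linear map it is always analytic, so the content of ``analytically'' is that
  its inverse is analytic as well: \<open>C\<close> is the graph of an analytic function of \<open>a > 0\<close>.\<close>

definition bijectively_analytically_projected :: "(real \<times> real) set \<Rightarrow> bool" where
  "bijectively_analytically_projected C \<longleftrightarrow>
     bij_betw fst C {0<..} \<and> real_analytic_on (\<lambda>a. snd (inv_into C fst a)) {0<..}"

end

theory Submission
  imports Defs
begin

text \<open>
  Writing \<open>cis \<theta> = cis (l t + s sin t) u / v\<close> linearises the equation. If \<open>h = Id\<close>, all solutions
  \<open>(u, v)\<close> are \<open>2\<pi>\<close>-periodic (the multiplier \<open>- 1\<close> is impossible), and the Fourier coefficients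
  \<open>p\<^sub>n\<close> of \<open>u'\<close> satisfy \<open>p\<^sub>0 = 0\<close> and
  \<open>(n + l + a\<^sup>2 / (4 n)) p\<^sub>n + s / 2 (p\<^sub>n\<^sub>-\<^sub>1 + p\<^sub>n\<^sub>+\<^sub>1) = 0\<close>. Hence (taking
  \<open>- n\<close> for \<open>n\<close> if \<open>l < 0\<close>, and alternating signs if \<open>l \<ge> 0\<close>) the half-line Jacobi matrix with diagonal
  \<open>n + \<bar>l\<bar> + a\<^sup>2 / (4 n)\<close> and off-diagonal entries \<open>- s / 2\<close> has a bounded kernel vector, which
  then decays geometrically. As the diagonal increases with \<open>a\<close>, the set \<open>K\<close> of all \<open>(a, s)\<close> with such
  a kernel vector consists locally of increasing graphs over \<open>a\<close>, up to and including \<open>a = 0\<close>, where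
  \<open>K\<close> is the zero set of \<open>J\<^sub>l\<close> because the kernel vector is then, up to a factor, the sequence of the \<open>J\<^sub>m\<^sub>+\<^sub>n(s)\<close> with
  \<open>m = \<bar>l\<bar>\<close>. Moreover \<open>s > 1 / 2\<close>
  on \<open>K\<close>. So a curve that is a graph over \<open>a > 0\<close> decreases, as \<open>a \<rightarrow> 0\<close>, to a positive zero of \<open>J\<^sub>l\<close>,
  and no two curves have the same limit.
\<close>

subsection \<open>Kernels of half-line Jacobi matrices\<close>

definition jac_diag :: "nat \<Rightarrow> real \<Rightarrow> nat \<Rightarrow> real" where
  "jac_diag m a n = real n + real m + a\<^sup>2 / (4 * real n)"

text \<open>Every solution of the kernel equation vanishing at index 0 is a multiple of this one, so
  a nonzero bounded kernel vector exists exactly when this sequence is bounded.\<close>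

fun jac :: "nat \<Rightarrow> real \<Rightarrow> real \<Rightarrow> nat \<Rightarrow> real" where
  "jac m a s 0 = 0"
| "jac m a s (Suc 0) = 1"
| "jac m a s (Suc (Suc n)) = 2 / s * jac_diag m a (Suc n) * jac m a s (Suc n) - jac m a s n"

text \<open>\<open>a\<close> is left free so that landing points on the axis \<open>a = 0\<close>
  belong to the same set as the curves.\<close>

definition jac_kernel :: "nat \<Rightarrow> (real \<times> real) set" where
  "jac_kernel m = {(a, s). 0 < s \<and> Bseq (jac m a s)}"

lemma jac_diag_ge: "real n \<le> jac_diag m a n"
  by (simp add: jac_diag_def)

section \<open>Growth and decay in the three-term recurrence\<close>

lemma growing_imp_not_Bseq:
  fixes Y :: "nat \<Rightarrow> real"
  assumes "Y N \<noteq> 0" and grow: "\<And>n. n \<ge> N \<Longrightarrow> \<bar>Y (Suc n)\<bar> \<ge> 2 * \<bar>Y n\<bar>"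
  shows "\<not> Bseq Y"
proof
  assume "Bseq Y"
  then obtain B where B: "\<And>n. \<bar>Y n\<bar> \<le> B"
    by (auto simp: Bseq_def)
  have ge: "\<bar>Y (N + k)\<bar> \<ge> 2 ^ k * \<bar>Y N\<bar>" for k
  proof (induction k)
    case (Suc k)
    then show ?case using grow[of "N + k"] by simp
  qed simp
  obtain k where "B / \<bar>Y N\<bar> < 2 ^ k"
    using real_arch_pow[of 2] by auto
  then have "B < 2 ^ k * \<bar>Y N\<bar>"
    using assms(1) by (simp add: field_simps)
  with ge[of k] B[of "N + k"] show False by linarith
qed

text \<open>From index \<open>2 * s\<close> on, the coefficient in the recurrence is at least 4, and
  the preceding term takes away less than twice the current one, which leaves a factor 2.\<close>

lemma jac_dominance:
  assumes s: "0 < s" and n: "2 * s \<le> real (Suc n)"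
    and gt: "\<bar>jac m a s (Suc n)\<bar> > \<bar>jac m a s n\<bar> / 2"
  shows "\<bar>jac m a s (Suc (Suc n))\<bar> \<ge> 2 * \<bar>jac m a s (Suc n)\<bar>"
proof -
  have "4 \<le> 2 / s * jac_diag m a (Suc n)"
    using s n jac_diag_ge[of "Suc n" m a] by (simp add: field_simps)
  then have "4 * \<bar>jac m a s (Suc n)\<bar> \<le> \<bar>2 / s * jac_diag m a (Suc n) * jac m a s (Suc n)\<bar>"
    unfolding abs_mult[of "2 / s * jac_diag m a (Suc n)"]
    by (rule mult_right_mono[OF order_trans[OF _ abs_ge_self]]) auto
  with gt show ?thesis
    by simp
qed

text \<open>Doubling at one step is more than the hypothesis at the next, so growth beyond the
  threshold never stops.\<close>

lemma jac_not_Bseq: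
  assumes s: "0 < s" and n: "2 * s \<le> real (Suc n)"
    and gt: "\<bar>jac m a s (Suc n)\<bar> > \<bar>jac m a s n\<bar> / 2"
  shows "\<not> Bseq (jac m a s)"
proof -
  have *: "\<bar>jac m a s (Suc k)\<bar> > \<bar>jac m a s k\<bar> / 2 \<and>
    \<bar>jac m a s (Suc (Suc k))\<bar> \<ge> 2 * \<bar>jac m a s (Suc k)\<bar>" if "k \<ge> n" for k
    using that
  proof (induction k rule: dec_induct)
    case base
    show ?case using jac_dominance[OF s n gt] gt by blast
  next
    case (step k)
    have a: "\<bar>jac m a s (Suc (Suc k))\<bar> > \<bar>jac m a s (Suc k)\<bar> / 2"
      using step.IH by linarith
    have b: "2 * s \<le> real (Suc (Suc k))" using n step.hyps by linarith
    show ?case using a jac_dominance[OF s b a] by blast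
  qed
  show ?thesis
  proof (rule growing_imp_not_Bseq)
    show "jac m a s (Suc n) \<noteq> 0" using gt by auto
    show "2 * \<bar>jac m a s k\<bar> \<le> \<bar>jac m a s (Suc k)\<bar>" if "Suc n \<le> k" for k
      using *[of "k - 1"] that by (cases k) auto
  qed
qed

text \<open>Contrapositive of \<open>jac_not_Bseq\<close>; the threshold depends on \<open>s\<close>
  only, which makes it uniform near a point.\<close>

lemma jac_halving:
  assumes "(a, s) \<in> jac_kernel m" and n: "2 * s \<le> real (Suc n)"
  shows "\<bar>jac m a s (Suc n)\<bar> \<le> \<bar>jac m a s n\<bar> / 2"
  using assms jac_not_Bseq[of s n m a] by (force simp: jac_kernel_def)

lemma jac_kernel_gt_half:
  assumes "(a, s) \<in> jac_kernel m"
  shows "1 / 2 < s"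
proof (rule ccontr)
  assume "\<not> 1 / 2 < s"
  \<comment> \<open>The threshold is met already at index 0, where halving would give
    \<open>1 \<le> 0\<close>.\<close>
  then have "2 * s \<le> real (Suc 0)" by simp
  from jac_halving[OF assms this] show False by simp
qed

text \<open>Multiplying the recurrence by its middle term shows that consecutive terms never have
  opposite signs; the tail of a kernel vector keeps one sign.\<close>

lemma jac_tail_ratio:
  assumes k: "(a, s) \<in> jac_kernel m" and n: "2 * s \<le> real (Suc n)"
  shows "\<exists>r. 0 \<le> r \<and> r \<le> 1 / 2 \<and> jac m a s (Suc n) = r * jac m a s n"
proof (cases "jac m a s n = 0")
  case True
  then show ?thesis using jac_halving[OF k n] by (auto intro: exI[of _ 0])
next
  case False
  let ?x = "jac m a s n" and ?y = "jac m a s (Suc n)" and ?z = "jac m a s (Suc (Suc n))"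
  have s: "0 < s" using k by (simp add: jac_kernel_def)
  have d: "4 \<le> 2 / s * jac_diag m a (Suc n)"
    using s n jac_diag_ge[of "Suc n" m a] by (simp add: field_simps)
  have zy: "\<bar>?z\<bar> \<le> \<bar>?y\<bar> / 2" using jac_halving[OF k, of "Suc n"] n by simp
  have yx: "\<bar>?y\<bar> \<le> \<bar>?x\<bar> / 2" using jac_halving[OF k n] .
  have "?x = 2 / s * jac_diag m a (Suc n) * ?y - ?z" by simp
  then have e: "?y * ?x = 2 / s * jac_diag m a (Suc n) * (?y * ?y) - ?y * ?z"
    by (simp add: algebra_simps)
  have "4 * (?y * ?y) \<le> 2 / s * jac_diag m a (Suc n) * (?y * ?y)"
    by (intro mult_right_mono d) simp
  moreover have "\<bar>?y * ?z\<bar> \<le> ?y * ?y"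
  proof -
    have "\<bar>?y\<bar> * \<bar>?z\<bar> \<le> \<bar>?y\<bar> * \<bar>?y\<bar>" by (intro mult_left_mono) (use zy in linarith)+
    then show ?thesis by (simp only: abs_mult abs_mult_self_eq)
  qed
  ultimately have "0 \<le> ?y * ?x" unfolding e using zero_le_square[of ?y] by linarith
  then have r0: "0 \<le> ?y / ?x" by (simp add: zero_le_divide_iff zero_le_mult_iff)
  have "\<bar>?y / ?x\<bar> \<le> 1 / 2" using yx False by (simp add: field_simps)
  then have "?y / ?x \<le> 1 / 2" by linarith
  with r0 False show ?thesis by (intro exI[of _ "?y / ?x"]) auto
qed

lemma jac_tail:
  assumes k: "(a, s) \<in> jac_kernel m" and N: "2 * s \<le> real (Suc N)"
  shows "\<exists>r. 0 \<le> r \<and> r \<le> (1 / 2) ^ j \<and> jac m a s (N + j) = r * jac m a s N"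
proof (induction j)
  case 0
  show ?case by (auto intro: exI[of _ 1])
next
  case (Suc j)
  then obtain r where r: "0 \<le> r" "r \<le> (1 / 2) ^ j" "jac m a s (N + j) = r * jac m a s N" by auto
  obtain q where q: "0 \<le> q" "q \<le> 1 / 2" "jac m a s (Suc (N + j)) = q * jac m a s (N + j)"
    using jac_tail_ratio[OF k, of "N + j"] N by auto
  show ?case
    using r q mult_mono[OF q(2) r(2)] by (intro exI[of _ "q * r"]) auto
qed

lemma jac_tendsto_0:
  assumes k: "(a, s) \<in> jac_kernel m"
  shows "jac m a s \<longlonglongrightarrow> 0"
proof -
  obtain N :: nat where N: "2 * s \<le> real N" using real_arch_simple by blast
  have "(\<lambda>j. jac m a s (N + j)) \<longlonglongrightarrow> 0"
  proof (rule Lim_null_comparison)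
    show "\<forall>\<^sub>F j in sequentially. norm (jac m a s (N + j)) \<le> (1 / 2) ^ j * \<bar>jac m a s N\<bar>"
    proof (intro always_eventually allI)
      fix j
      obtain r where r: "0 \<le> r" "r \<le> (1 / 2) ^ j" "jac m a s (N + j) = r * jac m a s N"
        using jac_tail[OF k, of N j] N by auto
      show "norm (jac m a s (N + j)) \<le> (1 / 2) ^ j * \<bar>jac m a s N\<bar>"
        using r by (auto simp: abs_mult intro: mult_right_mono)
    qed
    show "(\<lambda>j. (1 / 2) ^ j * \<bar>jac m a s N\<bar>) \<longlonglongrightarrow> 0"
      by (intro tendsto_mult_left_zero LIMSEQ_power_zero) simp
  qed
  then show ?thesis
    by (subst (asm) add.commute) (rule LIMSEQ_offset)
qed

text \<open>By halving the next term would vanish too, and two neighbouring zeros run back down the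
  recurrence to index 1, where the value is 1.\<close>

lemma jac_nonzero:
  assumes k: "(a, s) \<in> jac_kernel m" and n: "2 * s \<le> real (Suc n)"
  shows "jac m a s n \<noteq> 0"
proof
  assume "jac m a s n = 0"
  moreover from this have "jac m a s (Suc n) = 0" using jac_halving[OF k n] by simp
  moreover have "jac m a s n = 0 \<Longrightarrow> jac m a s (Suc n) = 0 \<Longrightarrow> jac m a s (Suc 0) = 0"
    by (induction n) auto
  ultimately show False by simp
qed

section \<open>Closedness and local monotonicity of the kernel set\<close>

lemma isCont_jac:
  assumes "0 < snd p"
  shows "isCont (\<lambda>p. jac m (fst p) (snd p) n) p"
  using assms
proof (induction n rule: induct_nat_012)
  case (ge2 n)
  then show ?case unfolding jac.simps jac_diag_def by (intro continuous_intros) auto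
qed simp_all

text \<open>Boundedness alone does not pass to limits, but the halving inequalities do: each is a
  closed condition and their threshold can be chosen uniformly near \<open>p\<close>.\<close>

lemma jac_kernel_closed:
  assumes "p \<in> closure (jac_kernel m)" and s: "0 < snd p"
  shows "p \<in> jac_kernel m"
proof -
  obtain q where q: "\<And>j. q j \<in> jac_kernel m" "q \<longlonglongrightarrow> p"
    using assms(1) by (auto simp: closure_sequential)
  obtain N :: nat where N: "2 * (snd p + 1) \<le> real N" using real_arch_simple by blast
  have lim: "(\<lambda>j. jac m (fst (q j)) (snd (q j)) n) \<longlonglongrightarrow> jac m (fst p) (snd p) n" for n
    using isCont_tendsto_compose[OF isCont_jac[OF s] q(2)] .
  have ev: "\<forall>\<^sub>F j in sequentially. snd (q j) < snd p + 1"
    using tendsto_snd[OF q(2)] by (rule order_tendstoD) simp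
  have halve: "\<bar>jac m (fst p) (snd p) (Suc n)\<bar> \<le> \<bar>jac m (fst p) (snd p) n\<bar> / 2" if "n \<ge> N" for n
  proof (rule tendsto_le[OF sequentially_bot])
    show "(\<lambda>j. \<bar>jac m (fst (q j)) (snd (q j)) n\<bar> / 2) \<longlonglongrightarrow> \<bar>jac m (fst p) (snd p) n\<bar> / 2"
      by (intro tendsto_intros lim) simp
    show "(\<lambda>j. \<bar>jac m (fst (q j)) (snd (q j)) (Suc n)\<bar>) \<longlonglongrightarrow> \<bar>jac m (fst p) (snd p) (Suc n)\<bar>"
      by (intro tendsto_intros lim)
    show "\<forall>\<^sub>F j in sequentially. \<bar>jac m (fst (q j)) (snd (q j)) (Suc n)\<bar>
        \<le> \<bar>jac m (fst (q j)) (snd (q j)) n\<bar> / 2"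
      using ev
    proof eventually_elim
      case (elim j)
      show ?case
        by (rule jac_halving) (use q(1)[of j] elim N that in auto)
    qed
  qed
  have "\<bar>jac m (fst p) (snd p) n\<bar> \<le> \<bar>jac m (fst p) (snd p) N\<bar>" if "n \<ge> N" for n
    using that
  proof (induction n rule: dec_induct)
    case (step n)
    then show ?case using halve[of n] by linarith
  qed simp
  then have "Bseq (jac m (fst p) (snd p))"
    by - (rule Bseq_eventually_mono[where g = "\<lambda>_. jac m (fst p) (snd p) N"],
      auto simp: eventually_sequentially Bseq_def intro: exI[of _ "\<bar>jac m (fst p) (snd p) N\<bar> + 1"])
  then show ?thesis using s by (simp add: jac_kernel_def case_prod_beta)
qed

text \<open>Discrete Green identity: the difference of the two quadratic forms is a boundary term.\<close>

lemma jac_casorati: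
  assumes "s \<noteq> 0" "t \<noteq> 0"
  shows "(\<Sum>n=1..k. 2 * (jac_diag m b n / t - jac_diag m a n / s) * (jac m a s n * jac m b t n))
    = jac m a s k * jac m b t (Suc k) - jac m b t k * jac m a s (Suc k)"
proof (induction k)
  case (Suc k)
  have "2 * (jac_diag m b (Suc k) / t - jac_diag m a (Suc k) / s) * (x * y)
    = x * (2 / t * jac_diag m b (Suc k) * y) - y * (2 / s * jac_diag m a (Suc k) * x)" for x y
    by (simp add: algebra_simps)
  then show ?case
    by (subst sum.nat_ivl_Suc') (simp, simp only: Suc.IH, simp add: algebra_simps)
qed simp

text \<open>Two kernel points with \<open>a \<le> b\<close> and \<open>t \<le> s\<close> make every bracket in \<open>jac_casorati\<close> nonnegative, while
  near \<open>p\<close> both sequences almost agree; so the sum would stay positive, but it tends to \<open>0\<close>.\<close>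

lemma jac_kernel_monotone:
  assumes p: "p \<in> jac_kernel m"
  shows "\<exists>d>0. \<forall>a s b t. (a, s) \<in> jac_kernel m \<and> (b, t) \<in> jac_kernel m \<and>
    dist (a, s) p < d \<and> dist (b, t) p < d \<and> 0 \<le> a \<and> a \<le> b \<and> t \<le> s \<longrightarrow> a = b \<and> s = t"
proof -
  let ?Y = "\<lambda>p n. jac m (fst p) (snd p) n"
  have s: "0 < snd p" using p by (auto simp: jac_kernel_def)
  obtain N :: nat where N: "2 * (snd p + 1) \<le> real N" using real_arch_simple by blast
  have YN: "?Y p N \<noteq> 0" by (rule jac_nonzero) (use p N in auto)
  \<comment> \<open>Chosen for \<open>low\<close>: at most \<open>Suc N\<close> products above
    \<open>- e\<close>, with weights at most \<open>Suc N * c 1\<close>, lose at most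
    \<open>c 1 / 2\<close> altogether.\<close>
  define e where "e = 1 / (2 * real (Suc N) ^ 2)"
  have e: "e > 0" by (simp add: e_def)
  have cont: "((\<lambda>x. ?Y (fst x) n * ?Y (snd x) n) \<longlongrightarrow> ?Y p n * ?Y p n) (nhds p \<times>\<^sub>F nhds p)" for n
  proof -
    have *: "((\<lambda>p. ?Y p n) \<longlongrightarrow> ?Y p n) (nhds p)"
      using isCont_jac[OF s, of m n] unfolding isCont_def
      by (subst tendsto_at_iff_tendsto_nhds[symmetric])
    show ?thesis
      by (intro tendsto_mult filterlim_compose[OF * filterlim_fst] filterlim_compose[OF * filterlim_snd])
  qed
  \<comment> \<open>At \<open>(p, p)\<close> the products are squares and the one at
    \<open>N\<close> is positive, so both bounds persist for nearby pairs.\<close>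
  have "\<forall>\<^sub>F x in nhds p \<times>\<^sub>F nhds p. (\<forall>n\<in>{..N}. - e < ?Y (fst x) n * ?Y (snd x) n) \<and>
     0 < ?Y (fst x) N * ?Y (snd x) N"
  proof (intro eventually_conj eventually_ball_finite ballI order_tendstoD(1)[OF cont])
    show "- e < ?Y p n * ?Y p n" for n using e zero_le_square[of "?Y p n"] by linarith
    show "0 < ?Y p N * ?Y p N" using YN by (metis not_real_square_gt_zero)
  qed simp
  then obtain P Q where PQ: "eventually P (nhds p)" "eventually Q (nhds p)"
    "\<And>x y. P x \<Longrightarrow> Q y \<Longrightarrow> (\<forall>n\<in>{..N}. - e < ?Y x n * ?Y y n) \<and> 0 < ?Y x N * ?Y y N"
    unfolding eventually_prod_filter by auto
  obtain d1 where d1: "d1 > 0" "\<And>x. dist x p < d1 \<Longrightarrow> P x \<and> Q x"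
    using eventually_conj[OF PQ(1,2)] by (auto simp: eventually_nhds_metric)
  define d where "d = min d1 1"
  have "a = b \<and> s' = t"
    if h: "(a, s') \<in> jac_kernel m" "(b, t) \<in> jac_kernel m"
      "dist (a, s') p < d" "dist (b, t) p < d" "0 \<le> a" "a \<le> b" "t \<le> s'" for a s' b t
  proof (rule ccontr)
    assume ne: "\<not> (a = b \<and> s' = t)"
    define c where "c n = 2 * (jac_diag m b n / t - jac_diag m a n / s')" for n
    define X where "X n = jac m a s' n * jac m b t n" for n
    have t: "0 < t" "0 < s'" using h by (auto simp: jac_kernel_def)
    have X: "- e < X n" if "n \<le> N" for n
      using PQ(3) d1(2) h that by (auto simp: X_def d_def dest: spec)
    have XN: "0 < X N"
      using PQ(3)[of "(a,s')" "(b,t)"] d1(2) h by (auto simp: X_def d_def)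
    have sN: "2 * s' \<le> real (Suc N)" "2 * t \<le> real (Suc N)"
      using dist_snd_le[of "(a,s')" p] dist_snd_le[of "(b,t)" p] h N
      by (auto simp: d_def dist_real_def)
    \<comment> \<open>Beyond \<open>N\<close> both sequences are nonnegative multiples of their
      values at \<open>N\<close>, so the products inherit the sign of \<open>X N\<close>.\<close>
    have tail: "0 \<le> X (N + j)" for j
    proof -
      obtain r where "0 \<le> r" "jac m a s' (N + j) = r * jac m a s' N"
        using jac_tail[OF h(1) sN(1)] by blast
      moreover obtain q where "0 \<le> q" "jac m b t (N + j) = q * jac m b t N"
        using jac_tail[OF h(2) sN(2)] by blast
      ultimately have "X (N + j) = r * q * X N" "0 \<le> r * q" by (auto simp: X_def)
      then show ?thesis using XN by simp
    qed
    have inv: "1 / s' \<le> 1 / t" using t h(7) by (simp add: frac_le)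
    have sq: "a\<^sup>2 \<le> b\<^sup>2" using h by (simp add: power_mono)
    \<comment> \<open>The two summands separate the effect of \<open>t \<le> s'\<close> from that of
      \<open>a \<le> b\<close>; each is nonnegative.\<close>
    have c_eq: "c n = 2 * (jac_diag m b n * (1 / t - 1 / s') + (b\<^sup>2 - a\<^sup>2) / (4 * real n) / s')" for n
      unfolding c_def jac_diag_def by (simp add: algebra_simps diff_divide_distrib add_divide_distrib)
    have c0: "0 \<le> c n" for n
      unfolding c_eq using inv sq t jac_diag_ge[of n m b]
      by (intro mult_nonneg_nonneg add_nonneg_nonneg) (auto intro: order_trans[OF of_nat_0_le_iff])
    \<comment> \<open>With all weights bounded through \<open>c 1\<close>, the first term of the
      sum, equal to \<open>c 1\<close> because \<open>X 1 = 1\<close>, can absorb the negative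
      ones.\<close>
    have cn: "c n \<le> real n * c 1" if "n \<ge> 1" for n
    proof -
      have d: "jac_diag m b n \<le> real n * jac_diag m b 1"
      proof -
        have "real m \<le> real n * real m" "b\<^sup>2 / (4 * real n) \<le> real n * (b\<^sup>2 / 4)"
          using that mult_right_mono[of 1 "real n * real n" "b\<^sup>2"] mult_right_mono[of 1 "real n" "real m"]
          by (auto simp: field_simps mult_ge1_I)
        then show ?thesis by (simp add: jac_diag_def algebra_simps)
      qed
      have "(b\<^sup>2 - a\<^sup>2) / (4 * real n) \<le> real n * ((b\<^sup>2 - a\<^sup>2) / 4)"
        using that sq mult_right_mono[of 1 "real n * real n" "b\<^sup>2 - a\<^sup>2"]
        by (auto simp: field_simps mult_ge1_I)
      then have i1: "(b\<^sup>2 - a\<^sup>2) / (4 * real n) / s' \<le> real n * ((b\<^sup>2 - a\<^sup>2) / 4) / s'"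
        using t by (intro divide_right_mono) auto
      have i2: "jac_diag m b n * (1 / t - 1 / s') \<le> real n * jac_diag m b 1 * (1 / t - 1 / s')"
        using d inv by (intro mult_right_mono) auto
      have "real n * c 1 = 2 * (real n * jac_diag m b 1 * (1 / t - 1 / s') + real n * ((b\<^sup>2 - a\<^sup>2) / 4) / s')"
        unfolding c_eq using t by (simp add: field_simps)
      then show ?thesis unfolding c_eq[of n]
        by (simp only:) (intro mult_left_mono add_mono i1 i2; simp)
    qed
    have c1: "0 < c 1"
    proof (cases "s' = t")
      case True
      then have "a < b" using ne h by auto
      then have "a\<^sup>2 < b\<^sup>2" using h by (simp add: power_strict_mono)
      then show ?thesis using t True unfolding c_eq by simp
    next
      case False
      then have "1 / s' < 1 / t" using t h(7) by (simp add: frac_less2)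
      moreover have "0 < jac_diag m b 1" using jac_diag_ge[of 1 m b] by simp
      ultimately have "0 < jac_diag m b 1 * (1 / t - 1 / s')" by simp
      moreover have "0 \<le> (b\<^sup>2 - a\<^sup>2) / (4 * real 1) / s'" using sq t by simp
      ultimately show ?thesis
        unfolding c_eq by (rule mult_pos_pos[OF zero_less_numeral add_pos_nonneg])
    qed
    have low: "c 1 / 2 \<le> (\<Sum>n=1..Suc k. c n * X n)" for k
    proof -
      have "(\<Sum>n=2..Suc k. c n * X n) \<ge> (\<Sum>n=2..Suc k. if n \<le> N then - (real N * c 1 * e) else 0)"
      proof (intro sum_mono)
        fix n assume n: "n \<in> {2..Suc k}"
        show "(if n \<le> N then - (real N * c 1 * e) else 0) \<le> c n * X n"
        proof (cases "n \<le> N")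
          case True
          have "c n * X n \<ge> c n * (- e)" using X[OF True] c0 by (intro mult_left_mono) auto
          moreover have "c n \<le> real N * c 1" using cn[of n] n c1 True
            by (smt (verit) atLeastAtMost_iff mult_right_mono of_nat_mono one_le_numeral order_trans)
          then have "c n * e \<le> real N * c 1 * e" using e by (intro mult_right_mono) auto
          ultimately show ?thesis using True by simp
        next
          case False
          then show ?thesis using tail[of "n - N"] c0[of n] by simp
        qed
      qed
      moreover have "(\<Sum>n=2..Suc k. if n \<le> N then - (real N * c 1 * e) else 0) \<ge> - (c 1 / 2)"
      proof -
        have "(\<Sum>n=2..Suc k. if n \<le> N then - (real N * c 1 * e) else 0)
            = (\<Sum>n\<in>{2..Suc k} \<inter> {..N}. - (real N * c 1 * e))"
          by (subst sum.inter_restrict) auto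
        also have "\<dots> = - (real (card ({2..Suc k} \<inter> {..N})) * (real N * c 1 * e))" by simp
        also have "\<dots> \<ge> - (real (Suc N) * (real (Suc N) * c 1 * e))"
        proof -
          have "card ({2..Suc k} \<inter> {..N}) \<le> card {..N}" by (intro card_mono) auto
          then have "real (card ({2..Suc k} \<inter> {..N})) * (real N * c 1 * e) \<le> real (Suc N) * (real (Suc N) * c 1 * e)"
            using c1 e by (intro mult_mono) auto
          then show ?thesis by simp
        qed
        also have "- (real (Suc N) * (real (Suc N) * c 1 * e)) = - (c 1 / 2)"
          unfolding e_def power2_eq_square by (simp add: field_simps del: of_nat_Suc)
        finally show ?thesis .
      qed
      moreover have "(\<Sum>n=1..Suc k. c n * X n) = c 1 * X 1 + (\<Sum>n=2..Suc k. c n * X n)"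
        by (subst sum.atLeast_Suc_atMost) (auto simp: numeral_2_eq_2)
      moreover have "X 1 = 1" by (simp add: X_def)
      ultimately show ?thesis by simp
    qed
    have "(\<lambda>k. jac m a s' k * jac m b t (Suc k) - jac m b t k * jac m a s' (Suc k)) \<longlonglongrightarrow> 0 * 0 - 0 * 0"
      by (intro tendsto_intros jac_tendsto_0 h LIMSEQ_Suc)
    then have "(\<lambda>k. \<Sum>n=1..k. c n * X n) \<longlonglongrightarrow> 0"
      using jac_casorati[of s' t m b a] t by (simp add: c_def X_def)
    then have "(\<lambda>k. \<Sum>n=1..Suc k. c n * X n) \<longlonglongrightarrow> 0" by (rule LIMSEQ_Suc)
    then have "c 1 / 2 \<le> 0" by (rule LIMSEQ_le_const) (use low in blast)
    with c1 show False by simp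
  qed
  moreover have "d > 0" using d1 by (simp add: d_def)
  ultimately show ?thesis by blast
qed

subsection \<open>Bessel functions\<close>

text \<open>J_n for natural \<open>n\<close>, with factorials in place of \<open>rGamma\<close>, so
  that identities can be checked term by term.\<close>

definition bessel :: "nat \<Rightarrow> real \<Rightarrow> real" where
  "bessel n x = (\<Sum>j. (- 1) ^ j / (fact j * fact (j + n)) * (x / 2) ^ (2 * j + n))"

lemma half_power: "(x / 2) ^ (2 * j + n) = (x / 2) ^ n * ((x :: real)\<^sup>2 / 4) ^ j"
  by (simp add: power_add power_mult power_divide[of x 2 2])

lemma bessel_term_abs:
  fixes x :: real
  assumes "0 < x"
  shows "\<bar>(- 1) ^ j / (fact j * fact (j + n)) * (x / 2) ^ (2 * j + n)\<bar>
    = (x / 2) ^ (2 * j + n) / (fact j * fact (j + n))"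
  using assms by (simp add: abs_mult power_abs)

lemma bessel_term_le:
  fixes x :: real
  assumes "0 < x"
  shows "\<bar>(- 1) ^ j / (fact j * fact (j + n)) * (x / 2) ^ (2 * j + n)\<bar>
    \<le> (x / 2) ^ n / fact n * (inverse (fact j) * (x\<^sup>2 / 4) ^ j)"
proof -
  have "fact n \<le> (fact (j + n) :: real)" by (intro fact_mono) simp
  then have "(x / 2) ^ (2 * j + n) / (fact j * fact (j + n)) \<le> (x / 2) ^ (2 * j + n) / (fact j * fact n)"
    using assms by (intro divide_left_mono mult_left_mono) auto
  also have "\<dots> = (x / 2) ^ n / fact n * (inverse (fact j) * (x\<^sup>2 / 4) ^ j)"
    unfolding half_power by (simp add: inverse_eq_divide mult_ac)
  finally show ?thesis unfolding bessel_term_abs[OF assms] .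
qed

lemma summable_exp_real: "summable (\<lambda>j. c * (inverse (fact j) * (y :: real) ^ j))"
  by (rule summable_mult[OF summable_exp])

lemma summable_bessel:
  fixes x :: real
  assumes "0 < x"
  shows "summable (\<lambda>j. (- 1) ^ j / (fact j * fact (j + n)) * (x / 2) ^ (2 * j + n))"
  by (rule summable_comparison_test'[OF summable_exp_real])
    (rule bessel_term_le[OF assms, folded real_norm_def])

lemma bessel_bound:
  assumes "0 < x"
  shows "\<bar>bessel n x\<bar> \<le> (x / 2) ^ n / fact n * exp (x\<^sup>2 / 4)"
proof -
  have "\<bar>bessel n x\<bar> \<le> (\<Sum>j. (x / 2) ^ n / fact n * (inverse (fact j) * (x\<^sup>2 / 4) ^ j))"
    unfolding bessel_def real_norm_def[symmetric]
    by (rule norm_suminf_le[OF _ summable_exp_real])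
      (rule bessel_term_le[OF assms, folded real_norm_def])
  also have "\<dots> = (x / 2) ^ n / fact n * exp (x\<^sup>2 / 4)"
    using suminf_mult[OF summable_exp[of "x\<^sup>2 / 4"], of "(x / 2) ^ n / fact n"]
    by (simp add: exp_def inverse_eq_divide)
  finally show ?thesis .
qed

lemma Bseq_bessel:
  assumes "0 < x"
  shows "Bseq (\<lambda>n. bessel n x)"
proof (rule BseqI')
  fix n
  have "(x / 2) ^ n / fact n \<le> exp (x / 2)"
  proof -
    have "inverse (fact n) * (x / 2) ^ n \<le> (\<Sum>j. inverse (fact j) * (x / 2) ^ j)"
      using sum_le_suminf[OF summable_exp[of "x / 2"], of "{n}"] assms by simp
    then show ?thesis by (simp add: exp_def inverse_eq_divide)
  qed
  then have "(x / 2) ^ n / fact n * exp (x\<^sup>2 / 4) \<le> exp (x / 2) * exp (x\<^sup>2 / 4)"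
    by (intro mult_right_mono) auto
  then show "norm (bessel n x) \<le> exp (x / 2) * exp (x\<^sup>2 / 4)"
    using bessel_bound[OF assms, of n] by simp
qed

text \<open>This is the recurrence of \<open>jac\<close> at \<open>a = 0\<close> with orders shifted
  by \<open>m\<close>, since \<open>jac_diag m 0 n\<close> is \<open>n + m\<close>. It is proved
  term by term.\<close>

lemma bessel_recurrence:
  assumes x: "0 < x"
  shows "bessel n x + bessel (Suc (Suc n)) x = 2 * real (Suc n) / x * bessel (Suc n) x"
proof -
  let ?t = "\<lambda>n j. (- 1) ^ j / (fact j * fact (j + n)) * (x / 2) ^ (2 * j + n) :: real"
  \<comment> \<open>Shifting by one index makes the powers of \<open>x\<close> agree with those of
    order \<open>n\<close>.\<close>
  let ?u = "\<lambda>j. if j = 0 then 0 else ?t (Suc (Suc n)) (j - 1)"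
  have s: "?t k sums bessel k x" for k
    unfolding bessel_def using summable_bessel[OF x] by (rule summable_sums)
  have u: "?u sums bessel (Suc (Suc n)) x"
    using s[of "Suc (Suc n)"] sums_Suc_iff[of ?u "bessel (Suc (Suc n)) x"] by simp
  have "?t n j + ?u j = 2 * real (Suc n) / x * ?t (Suc n) j" for j
  proof (cases j)
    case 0
    then show ?thesis using x by (simp add: fact_Suc field_simps del: of_nat_Suc)
  next
    case (Suc i)
    define P A B c d where "P = (- 1) ^ i * (x / 2) ^ (2 * i + n + 2)" and "A = (fact i :: real)"
      and "B = (fact (i + n + 1) :: real)" and "c = real (Suc i)" and "d = real (i + n + 2)"
    have pos: "A > 0" "B > 0" "c > 0" "d > 0" "d - c = real (Suc n)"
      by (auto simp: A_def B_def c_def d_def)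
    have scale: "r * (- P / D) = 2 * r / x * (- P * (x / 2) / D)" for r D
      using x by (simp add: divide_simps)
    have f: "fact (Suc i) = c * A" "fact (Suc i + n) = B" "fact (Suc i + Suc n) = d * B"
      "fact (i + Suc (Suc n)) = d * B"
      by (simp_all add: A_def B_def c_def d_def add.assoc algebra_simps)
    have p: "(- 1) ^ Suc i * (x / 2) ^ (2 * Suc i + n) = - P" "(- 1) ^ i * (x / 2) ^ (2 * i + Suc (Suc n)) = P"
      "(- 1) ^ Suc i * (x / 2) ^ (2 * Suc i + Suc n) = - P * (x / 2)"
      by (simp_all add: P_def)
    have "?u (Suc i) = ?t (Suc (Suc n)) i" by simp
    then have "?t n (Suc i) + ?u (Suc i) = - P / (c * A * B) + P / (A * (d * B))"
      by (simp only: f p times_divide_eq_left A_def[symmetric])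
    \<comment> \<open>Over the common denominator the numerators combine to
      \<open>(d - c) * (- P)\<close>, and \<open>d - c = Suc n\<close> is the factor in the
      recurrence.\<close>
    also have "\<dots> = (d - c) * (- P / (c * A * (d * B)))"
      using pos(1-4) by (simp add: field_simps)
    also have "(d - c) * (- P / (c * A * (d * B)))
        = 2 * real (Suc n) / x * (- P * (x / 2) / (c * A * (d * B)))"
      unfolding pos(5) using scale .
    also have "\<dots> = 2 * real (Suc n) / x * ?t (Suc n) (Suc i)"
      by (simp only: f p times_divide_eq_left)
    finally show ?thesis using Suc by simp
  qed
  then have "(\<lambda>j. 2 * real (Suc n) / x * ?t (Suc n) j) sums (bessel n x + bessel (Suc (Suc n)) x)"
    using sums_add[OF s[of n] u] by simp
  with sums_mult[OF s[of "Suc n"], of "2 * real (Suc n) / x"] show ?thesis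
    using sums_unique2 by blast
qed

text \<open>The terms after the first have at least \<open>fact (Suc n)\<close> in the denominator,
  and the extra \<open>Suc n\<close> beats the exponential. This excludes that all high orders
  vanish at \<open>x\<close>.\<close>

lemma bessel_pos:
  assumes x: "0 < x" and n: "exp (x\<^sup>2 / 4) < real (Suc n)"
  shows "0 < bessel n x"
proof -
  let ?t = "\<lambda>j. (- 1) ^ j / (fact j * fact (j + n)) * (x / 2) ^ (2 * j + n) :: real"
  let ?c = "(x / 2) ^ n / fact n / real (Suc n)"
  have le: "\<bar>?t (Suc j)\<bar> \<le> ?c * (inverse (fact (Suc j)) * (x\<^sup>2 / 4) ^ Suc j)" for j
  proof -
    have "fact (Suc n) \<le> (fact (Suc j + n) :: real)" by (intro fact_mono) simp
    then have "(x / 2) ^ (2 * Suc j + n) / (fact (Suc j) * fact (Suc j + n))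
        \<le> (x / 2) ^ (2 * Suc j + n) / (fact (Suc j) * fact (Suc n))"
      using x by (intro divide_left_mono mult_left_mono mult_pos_pos zero_le_power) auto
    also have "\<dots> = ?c * (inverse (fact (Suc j)) * (x\<^sup>2 / 4) ^ Suc j)"
      unfolding half_power fact_Suc[of n] by (simp add: divide_simps del: of_nat_Suc fact_Suc)
    finally show ?thesis unfolding bessel_term_abs[OF x] .
  qed
  have 1: "summable (\<lambda>j. inverse (fact (Suc j)) * (x\<^sup>2 / 4) ^ Suc j)"
    using summable_exp[of "x\<^sup>2 / 4"] by (subst summable_Suc_iff)
  have sum: "summable (\<lambda>j. ?c * (inverse (fact (Suc j)) * (x\<^sup>2 / 4) ^ Suc j))"
    by (rule summable_mult[OF 1])
  have "bessel n x = ?t 0 + (\<Sum>j. ?t (Suc j))"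
    unfolding bessel_def using suminf_split_head[OF summable_bessel[OF x, of n]] by simp
  moreover have "\<bar>\<Sum>j. ?t (Suc j)\<bar> \<le> (\<Sum>j. ?c * (inverse (fact (Suc j)) * (x\<^sup>2 / 4) ^ Suc j))"
    unfolding real_norm_def[symmetric]
    by (rule norm_suminf_le[OF _ sum]) (rule le[folded real_norm_def])
  moreover have "(\<Sum>j. ?c * (inverse (fact (Suc j)) * (x\<^sup>2 / 4) ^ Suc j)) = ?c * (exp (x\<^sup>2 / 4) - 1)"
  proof -
    have "(\<Sum>j. inverse (fact (Suc j)) * (x\<^sup>2 / 4) ^ Suc j) = exp (x\<^sup>2 / 4) - 1"
      using suminf_split_head[OF summable_exp[of "x\<^sup>2 / 4"]]
      by (simp add: exp_def scaleR_conv_of_real del: fact_Suc power_Suc)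
    then show ?thesis using suminf_mult[OF 1, of ?c] by (simp only:)
  qed
  moreover have "?c * (exp (x\<^sup>2 / 4) - 1) < ?t 0"
  proof -
    have "(exp (x\<^sup>2 / 4) - 1) / real (Suc n) < 1" using n by (simp add: field_simps)
    moreover have "0 < (x / 2) ^ n / fact n" using x by simp
    ultimately have "(x / 2) ^ n / fact n * ((exp (x\<^sup>2 / 4) - 1) / real (Suc n)) < (x / 2) ^ n / fact n * 1"
      by (intro mult_strict_left_mono)
    then show ?thesis by simp
  qed
  ultimately show ?thesis by linarith
qed

section \<open>Zeros of Bessel functions and the kernel at \<open>a = 0\<close>\<close>

lemma Bessel_J_of_nat:
  assumes x: "0 < x"
  shows "Bessel_J (int n) x = bessel n x"
proof -
  have g: "rGamma (of_int (int j + int n + 1)) = inverse (fact (j + n) :: real)" for j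
    using Gamma_fact[of "j + n", where 'a = real]
    by (simp add: rGamma_inverse_Gamma add.commute)
  have p: "(x / 2) powi (2 * int j + int n) = (x / 2) ^ (2 * j + n)" for j
    using power_int_of_nat[of "x / 2" "2 * j + n"] by simp
  show ?thesis
    unfolding Bessel_J_def bessel_def g p by (simp add: inverse_eq_divide)
qed

text \<open>The terms with index below \<open>n\<close> vanish at the poles of Gamma; shifting the
  others by \<open>n\<close> gives the series of order \<open>n\<close> and the sign.\<close>

lemma Bessel_J_uminus_of_nat:
  assumes x: "0 < x"
  shows "Bessel_J (- int n) x = (- 1) ^ n * bessel n x"
proof -
  let ?t = "\<lambda>m. (-1) ^ m / fact m * rGamma (of_int (int m + - int n + 1)) * (x / 2) powi (2 * int m + - int n)"
  let ?b = "\<lambda>j. (- 1) ^ j / (fact j * fact (j + n)) * (x / 2) ^ (2 * j + n) :: real"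
  have low: "?t m = 0" if "m < n" for m
  proof -
    have "of_int (int m + - int n + 1) \<in> (\<int>\<^sub>\<le>\<^sub>0 :: real set)"
      using that by (intro nonpos_Ints_of_int) simp
    then show ?thesis by (simp add: rGamma_eq_zero_iff del: of_int_add of_int_diff)
  qed
  have shift: "?t (j + n) = (- 1) ^ n * ?b j" for j
  proof -
    have g: "rGamma (of_int (int (j + n) + - int n + 1)) = inverse (fact j :: real)"
      using Gamma_fact[of j, where 'a = real] by (simp add: rGamma_inverse_Gamma add.commute)
    have p: "(x / 2) powi (2 * int (j + n) + - int n) = (x / 2) ^ (2 * j + n)"
      using power_int_of_nat[of "x / 2" "2 * j + n"] by (simp add: algebra_simps)
    show ?thesis unfolding g p by (simp add: power_add inverse_eq_divide mult_ac)
  qed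
  have "(\<lambda>j. ?t (j + n)) sums ((- 1) ^ n * bessel n x)"
    unfolding shift bessel_def by (intro sums_mult summable_sums summable_bessel x)
  then have "?t sums ((- 1) ^ n * bessel n x + (\<Sum>m<n. ?t m))"
    by (rule sums_iff_shift[THEN iffD1])
  moreover have "(\<Sum>m<n. ?t m) = 0"
    using low by (intro sum.neutral) blast
  ultimately have "?t sums ((- 1) ^ n * bessel n x)" by (simp only: add_0_right)
  then show ?thesis
    unfolding Bessel_J_def by (rule sums_unique[symmetric])
qed

lemma Bessel_J_eq_0_iff:
  assumes "0 < x"
  shows "Bessel_J l x = 0 \<longleftrightarrow> bessel (nat \<bar>l\<bar>) x = 0"
  using Bessel_J_of_nat[OF assms, of "nat l"] Bessel_J_uminus_of_nat[OF assms, of "nat (- l)"]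
  by (cases "0 \<le> l") auto

text \<open>The Bessel functions of orders \<open>m + n\<close> satisfy the recurrence of
  \<open>jac\<close> at \<open>a = 0\<close>. A bounded \<open>jac\<close> has zero Casoratian with
  them; conversely, a zero at order \<open>m\<close> makes them a multiple of
  \<open>jac\<close>.\<close>

lemma jac_kernel_0_iff:
  assumes x: "0 < x"
  shows "(0, x) \<in> jac_kernel m \<longleftrightarrow> bessel m x = 0"
proof
  assume k: "(0, x) \<in> jac_kernel m"
  \<comment> \<open>Constant in \<open>n\<close>, with limit 0 since one factor tends to 0 and the
    other is bounded; \<open>W 0\<close> is \<open>- bessel m x\<close>.\<close>
  define W where "W n = jac m 0 x n * bessel (m + Suc n) x - jac m 0 x (Suc n) * bessel (m + n) x" for n
  have "W n = W 0" for n
  proof (induction n)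
    case (Suc n)
    have b: "bessel (m + Suc (Suc n)) x = 2 * real (Suc (m + n)) / x * bessel (m + Suc n) x - bessel (m + n) x"
      using bessel_recurrence[OF x, of "m + n"] by simp
    have "W (Suc n) = W n" unfolding W_def b
      by (simp add: jac_diag_def algebra_simps add_divide_distrib)
    then show ?case using Suc.IH by simp
  qed simp
  moreover have "W \<longlonglongrightarrow> 0"
  proof -
    have B: "Bseq (\<lambda>n. bessel (m + n) x)" "Bseq (\<lambda>n. bessel (m + Suc n) x)"
      using Bseq_subseq[OF Bseq_bessel[OF x], of "\<lambda>n. m + n"] Bseq_subseq[OF Bseq_bessel[OF x], of "\<lambda>n. m + Suc n"]
      by simp_all
    have J: "Zfun (jac m 0 x) sequentially" "Zfun (\<lambda>n. jac m 0 x (Suc n)) sequentially"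
      using jac_tendsto_0[OF k] LIMSEQ_Suc[OF jac_tendsto_0[OF k]] by (simp_all add: tendsto_Zfun_iff)
    have "Zfun W sequentially" unfolding W_def
      using bounded_bilinear.Zfun_prod_Bfun[OF bounded_bilinear_mult J(1) B(2)]
        bounded_bilinear.Zfun_prod_Bfun[OF bounded_bilinear_mult J(2) B(1)]
      by (rule Zfun_diff)
    then show ?thesis by (simp add: tendsto_Zfun_iff)
  qed
  ultimately have "W 0 = 0"
    by (metis LIMSEQ_const_iff LIMSEQ_unique ext)
  then show "bessel m x = 0" by (simp add: W_def)
next
  assume 0: "bessel m x = 0"
  \<comment> \<open>Two neighbouring zeros would annihilate all higher orders, against
    \<open>bessel_pos\<close>.\<close>
  have nz: "bessel (Suc m) x \<noteq> 0"
  proof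
    assume 1: "bessel (Suc m) x = 0"
    have "bessel (m + n) x = 0 \<and> bessel (Suc (m + n)) x = 0" for n
    proof (induction n)
      case (Suc n)
      then show ?case using bessel_recurrence[OF x, of "m + n"] by simp
    qed (use 0 1 in simp)
    moreover obtain n where "exp (x\<^sup>2 / 4) < real n" using reals_Archimedean2 by blast
    ultimately show False using bessel_pos[OF x, of "m + n"] by force
  qed
  have eq: "jac m 0 x n = bessel (m + n) x / bessel (Suc m) x" for n
  proof (induction n rule: induct_nat_012)
    case (ge2 n)
    have b: "bessel (m + Suc (Suc n)) x = 2 * real (Suc (m + n)) / x * bessel (m + Suc n) x - bessel (m + n) x"
      using bessel_recurrence[OF x, of "m + n"] by simp
    show ?case unfolding b jac.simps ge2.IH by (simp add: jac_diag_def algebra_simps diff_divide_distrib add_divide_distrib)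
  qed (use 0 nz in simp_all)
  have "Bseq (\<lambda>n. bessel (m + n) x)"
    using Bseq_subseq[OF Bseq_bessel[OF x], of "\<lambda>n. m + n"] by simp
  then have "Bseq (jac m 0 x)"
    using Bseq_cmult_iff[of "inverse (bessel (Suc m) x)" "\<lambda>n. bessel (m + n) x"] nz
    by (simp add: eq[abs_def] divide_inverse mult.commute)
  then show "(0, x) \<in> jac_kernel m" using x by (simp add: jac_kernel_def)
qed

subsection \<open>Fourier uniqueness and global solutions\<close>

lemma continuous_on_of_real_polynomial_cis:
  assumes "real_polynomial_function q"
  shows "continuous_on S (\<lambda>t. complex_of_real (q (cis t)))"
  using continuous_on_polymonial_function[OF assms[unfolded real_polynomial_function_eq], of UNIV]
  by (intro continuous_on_of_real continuous_on_compose2[where f = cis and t = UNIV and g = q])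
    (auto intro: continuous_intros)

lemma integral_linear_combination:
  fixes f g :: "real \<Rightarrow> complex"
  assumes "continuous_on {a..b} f" "continuous_on {a..b} g"
  shows "integral {a..b} (\<lambda>t. c * f t + d * g t) = c * integral {a..b} f + d * integral {a..b} g"
  using assms
  by (subst integral_add) (auto intro!: integrable_continuous_interval continuous_intros)

text \<open>A real-linear function of \<open>cis t\<close> only shifts frequencies by one, so the
  vanishing of all coefficients survives multiplication by real polynomials in \<open>cis t\<close>,
  the functions that Stone-Weierstrass supplies.\<close>

lemma integral_times_real_polynomial_eq_0:
  fixes h :: "real \<Rightarrow> complex"
  assumes q: "real_polynomial_function q"
    and h: "continuous_on {0..2*pi} h"
    and zero: "\<And>n::int. integral {0..2*pi} (\<lambda>t. h t * cis (of_int n * t)) = 0"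
  shows "integral {0..2*pi} (\<lambda>t. h t * of_real (q (cis t)) * cis (of_int n * t)) = 0"
  using q h zero
proof (induction q arbitrary: h n rule: real_polynomial_function.induct)
  case (linear q)
  interpret bounded_linear q by fact
  \<comment> \<open>A real-linear functional of \<open>z\<close> is
    \<open>2 * Re (\<alpha> * z)\<close> with this \<alpha>; on the circle it has the frequencies 1
    and - 1.\<close>
  define \<alpha> where "\<alpha> = Complex (q 1 / 2) (- q \<i> / 2)"
  have q: "of_real (q (cis t)) = \<alpha> * cis t + cnj \<alpha> * cis (- t)" for t
  proof -
    have "q (cis t) = q (cos t *\<^sub>R 1 + sin t *\<^sub>R \<i>)"
      by (rule arg_cong[where f = q]) (simp add: complex_eq_iff)
    also have "\<dots> = cos t * q 1 + sin t * q \<i>" by (simp add: add scaleR)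
    finally show ?thesis by (simp add: complex_eq_iff \<alpha>_def)
  qed
  have cis: "cis t * cis (of_int n * t) = cis (of_int (n + 1) * t)"
    "cis (- t) * cis (of_int n * t) = cis (of_int (n - 1) * t)" for t
    by (simp_all add: cis_mult algebra_simps)
  have "h t * of_real (q (cis t)) * cis (of_int n * t)
      = \<alpha> * (h t * cis (of_int (n + 1) * t)) + cnj \<alpha> * (h t * cis (of_int (n - 1) * t))" for t
    unfolding q cis[symmetric] by (simp add: algebra_simps)
  then show ?case
    using linear.prems(2)[of "n + 1"] linear.prems(2)[of "n - 1"]
    by (simp only:, subst integral_linear_combination)
      (auto intro!: continuous_intros linear.prems(1))
next
  case (const c)
  have "h t * of_real c * cis (of_int n * t) = of_real c * (h t * cis (of_int n * t))" for t
    by simp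
  then show ?case by (simp only: integral_mult_right const.prems(2) mult_zero_right)
next
  case (add f g)
  have "h t * of_real (f (cis t) + g (cis t)) * cis (of_int n * t)
     = h t * of_real (f (cis t)) * cis (of_int n * t) + h t * of_real (g (cis t)) * cis (of_int n * t)" for t
    by (simp add: algebra_simps)
  then show ?case using add.IH(1)[OF add.prems, of n] add.IH(2)[OF add.prems, of n]
    by (simp only:, subst integral_add)
      (auto intro!: integrable_continuous_interval continuous_intros add.prems(1)
        continuous_on_of_real_polynomial_cis add.hyps simp del: of_real_add)
next
  case (mult f g)
  \<comment> \<open>The second induction hypothesis is applied to the product of \<open>h\<close>
    and \<open>f (cis t)\<close>, whose coefficients all vanish by the first.\<close>
  have "integral {0..2*pi} (\<lambda>t. (h t * of_real (f (cis t))) * of_real (g (cis t)) * cis (of_int n * t)) = 0"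
  proof (rule mult.IH(2))
    show "continuous_on {0..2*pi} (\<lambda>t. h t * of_real (f (cis t)))"
      by (intro continuous_intros mult.prems(1) continuous_on_of_real_polynomial_cis mult.hyps)
  qed (rule mult.IH(1)[OF mult.prems])
  then show ?case by (simp add: mult.assoc)
qed

text \<open>Preimages of closed sets under the induced \<open>F\<close> are images under
  \<open>cis\<close> of compact sets, hence closed; this covers the glued endpoint as well.\<close>

lemma continuous_on_sphere_of_periodic:
  fixes f :: "real \<Rightarrow> 'a::topological_space"
  assumes f: "continuous_on {0..2*pi} f" and per: "f (2*pi) = f 0"
  obtains F where "continuous_on (sphere (0::complex) 1) F" "\<And>t. t \<in> {0..2*pi} \<Longrightarrow> F (cis t) = f t"
proof -
  define F where "F z = f (Arg2pi z)" for z
  have F: "F (cis t) = f t" if "t \<in> {0..2*pi}" for t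
  proof (cases "t = 2*pi")
    case True
    then show ?thesis using per Arg2pi_unique[of 1 0 1] by (simp add: F_def)
  next
    case False
    then have "Arg2pi (cis t) = t"
      using that by (intro Arg2pi_unique[of 1]) (auto simp: cis_conv_exp)
    then show ?thesis by (simp add: F_def)
  qed
  have sph: "sphere 0 1 = cis ` {0..2*pi}"
  proof
    show "sphere 0 1 \<subseteq> cis ` {0..2*pi}"
    proof
      fix z :: complex assume "z \<in> sphere 0 1"
      then have "z = cis (Arg2pi z)" using Arg2pi_eq[of z] by (simp add: cis_conv_exp)
      then show "z \<in> cis ` {0..2*pi}"
        using Arg2pi_ge_0[of z] Arg2pi_lt_2pi[of z] by (intro image_eqI) auto
    qed
  qed (auto simp: dist_norm)
  have "continuous_on (sphere 0 1) F"
    unfolding continuous_on_closed_vimage[OF closed_sphere]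
  proof (intro allI impI)
    fix B :: "'a set" assume "closed B"
    have "F -` B \<inter> sphere 0 1 = cis ` (f -` B \<inter> {0..2*pi})"
      unfolding sph using F by force
    moreover have "compact (f -` B \<inter> {0..2*pi})"
      using continuous_closed_preimage[OF f _ \<open>closed B\<close>]
      by (simp add: compact_eq_bounded_closed Int_commute bounded_subset[of "{0..2*pi}"])
    then have "closed (cis ` (f -` B \<inter> {0..2*pi}))"
      by (intro compact_imp_closed compact_continuous_image continuous_intros)
    ultimately show "closed (F -` B \<inter> sphere 0 1)" by simp
  qed
  with F that show thesis by blast
qed

text \<open>The conjugate of \<open>f\<close> is uniformly close to a polynomial in
  \<open>cis t\<close>, whose integral against \<open>f\<close> is 0; hence the integral of |f|^2 is
  arbitrarily small.\<close>

lemma Fourier_coefficients_zero_imp_zero: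
  fixes f :: "real \<Rightarrow> complex"
  assumes f: "continuous_on {0..2*pi} f" and per: "f (2*pi) = f 0"
    and zero: "\<And>n::int. integral {0..2*pi} (\<lambda>t. f t * cis (of_int n * t)) = 0"
    and t: "t \<in> {0..2*pi}"
  shows "f t = 0"
proof -
  obtain F where F: "continuous_on (sphere (0::complex) 1) F" "\<And>t. t \<in> {0..2*pi} \<Longrightarrow> F (cis t) = cnj (f t)"
    using continuous_on_sphere_of_periodic[of "\<lambda>t. cnj (f t)"] continuous_on_cnj[OF f] per
    by (metis (no_types, lifting) )
  obtain B where B: "\<And>t. t \<in> {0..2*pi} \<Longrightarrow> norm (f t) \<le> B"
    using compact_imp_bounded[OF compact_continuous_image[OF f compact_Icc]]
    unfolding bounded_iff by blast
  have B0: "B \<ge> 0" using B[of 0] norm_ge_zero[of "f 0"] by (simp del: norm_ge_zero)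
  have int: "(\<lambda>t. f t * cnj (f t)) integrable_on {0..2*pi}"
    by (intro integrable_continuous_interval continuous_intros f)
  have small: "norm (integral {0..2*pi} (\<lambda>t. f t * cnj (f t))) \<le> B * e * (2 * pi - 0)" if e: "e > 0" for e
  proof -
    obtain P where P: "polynomial_function P" "\<And>z. z \<in> sphere 0 1 \<Longrightarrow> norm (F z - P z) < e"
      using Stone_Weierstrass_polynomial_function[OF compact_sphere F(1) e] by blast
    have rP: "real_polynomial_function (\<lambda>z. Re (P z))" "real_polynomial_function (\<lambda>z. Im (P z))"
      using P(1) bounded_linear_Re bounded_linear_Im by (auto simp: polynomial_function_def o_def)
    have contP: "continuous_on {0..2*pi} (\<lambda>t. P (cis t))"
      using continuous_on_polymonial_function[OF P(1), of UNIV]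
      by (rule continuous_on_compose2) (auto intro: continuous_intros)
    have "integral {0..2*pi} (\<lambda>t. f t * P (cis t)) = 0"
    proof -
      have "f t * P (cis t) = f t * of_real (Re (P (cis t))) + \<i> * (f t * of_real (Im (P (cis t))))" for t
        by (simp add: complex_eq_iff algebra_simps)
      then have "integral {0..2*pi} (\<lambda>t. f t * P (cis t))
         = integral {0..2*pi} (\<lambda>t. f t * of_real (Re (P (cis t))) + \<i> * (f t * of_real (Im (P (cis t)))))"
        by simp
      also have "\<dots> = 0"
        using integral_times_real_polynomial_eq_0[OF rP(1) f zero, of 0]
          integral_times_real_polynomial_eq_0[OF rP(2) f zero, of 0]
        by (subst integral_add)
          (auto intro!: integrable_continuous_interval continuous_intros f
            continuous_on_of_real_polynomial_cis rP[THEN continuous_on_of_real_polynomial_cis] simp: integral_mult_right)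
      finally show ?thesis .
    qed
    then have "integral {0..2*pi} (\<lambda>t. f t * cnj (f t))
        = integral {0..2*pi} (\<lambda>t. f t * cnj (f t) - f t * P (cis t))"
      by (subst integral_diff) (auto intro!: integrable_continuous_interval continuous_intros f contP)
    also have "norm \<dots> \<le> B * e * (2 * pi - 0)"
    proof (rule integral_bound)
      fix t :: real assume t: "t \<in> {0..2*pi}"
      have "norm (cnj (f t) - P (cis t)) \<le> e"
        using P(2)[of "cis t"] F(2)[OF t] by (simp add: less_imp_le)
      then have "norm (f t) * norm (cnj (f t) - P (cis t)) \<le> B * e"
        using B[OF t] B0 by (intro mult_mono) auto
      then show "norm (f t * cnj (f t) - f t * P (cis t)) \<le> B * e"
        by (simp add: right_diff_distrib[symmetric] norm_mult)
    qed (auto intro!: continuous_intros f contP)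
    finally show ?thesis .
  qed
  have "norm (integral {0..2*pi} (\<lambda>t. f t * cnj (f t))) \<le> 0"
  proof (rule field_le_epsilon)
    fix d :: real assume d: "d > 0"
    \<comment> \<open>The accuracy used is \<open>d / ((B + 1) * (2 * pi))\<close>;
      \<open>B + 1\<close> keeps the divisor positive when \<open>B = 0\<close>.\<close>
    have gen: "B * (d / (K * P)) * (P - 0) = d * (B / K)" if "P \<noteq> 0" for K P
      using that by simp
    have "norm (integral {0..2*pi} (\<lambda>t. f t * cnj (f t))) \<le> B * (d / ((B + 1) * (2 * pi))) * (2 * pi - 0)"
      using small[of "d / ((B + 1) * (2 * pi))"] d B0 by simp
    also have "\<dots> = d * (B / (B + 1))" by (rule gen) simp
    also have "\<dots> \<le> d * 1" using B0 d by (intro mult_left_mono) auto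
    finally show "norm (integral {0..2*pi} (\<lambda>t. f t * cnj (f t))) \<le> 0 + d" by simp
  qed
  then have "integral {0..2*pi} (\<lambda>t. f t * cnj (f t)) = 0" by simp
  then have "integral {0..2*pi} (\<lambda>t. Re (f t * cnj (f t))) = 0"
    using integral_linear[OF int bounded_linear_Re] by (simp add: o_def)
  then have "\<forall>t\<in>{0..2*pi}. Re (f t * cnj (f t)) = 0"
    by (subst (asm) integral_eq_0_iff) (auto intro!: continuous_intros f simp: complex_mult_cnj)
  with t have "Re (f t * cnj (f t)) = 0" by blast
  then show ?thesis by (simp add: complex_mult_cnj complex_eq_iff sum_power2_eq_zero_iff)
qed

text \<open>Picard iteration is a contraction for the norm weighted by \<open>exp (- 2 L t)\<close>.\<close>

lemma lipschitz_ode_exists: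
  fixes f :: "real \<Rightarrow> real \<Rightarrow> real"
  assumes cont: "continuous_on UNIV (\<lambda>p. f (fst p) (snd p))"
    and lip: "\<And>t y z. \<bar>f t y - f t z\<bar> \<le> L * \<bar>y - z\<bar>"
    and L: "0 < L" and T: "0 \<le> T"
  obtains y where "y 0 = y0" "\<And>t. t \<in> {0..T} \<Longrightarrow> (y has_real_derivative f t (y t)) (at t within {0..T})"
proof -
  \<comment> \<open>The unknown \<zeta> stands for \<open>exp (- 2 * L * t) * y t\<close>, so its
    sup norm is the weighted norm of \<open>y\<close>.\<close>
  define I where "I \<zeta> x = integral {0..x} (\<lambda>\<sigma>. f \<sigma> (exp (2 * L * \<sigma>) * apply_bcontfun \<zeta> \<sigma>))" for \<zeta> :: "real \<Rightarrow>\<^sub>C real" and x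
  \<comment> \<open>Clamping \<open>t\<close> to \<open>{0..T}\<close> makes each iterate a bounded
    continuous function on the whole line, a point of a complete space.\<close>
  define G where "G \<zeta> t = (let x = min (max 0 t) T in exp (- (2 * L * x)) * (y0 + I \<zeta> x))" for \<zeta> t
  have c: "continuous_on S (\<lambda>\<sigma>. f \<sigma> (exp (2 * L * \<sigma>) * apply_bcontfun \<zeta> \<sigma>))" for \<zeta> S
    by (rule continuous_on_compose2[OF cont, of _ "\<lambda>\<sigma>. (\<sigma>, exp (2 * L * \<sigma>) * apply_bcontfun \<zeta> \<sigma>)", simplified])
      (intro continuous_intros continuous_on_apply_bcontfun)
  have i: "(\<lambda>\<sigma>. f \<sigma> (exp (2 * L * \<sigma>) * apply_bcontfun \<zeta> \<sigma>)) integrable_on {0..x}" for \<zeta> x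
    by (intro integrable_continuous_interval c)
  have cG0: "continuous_on {0..T} (\<lambda>x. exp (- (2 * L * x)) * (y0 + I \<zeta> x))" for \<zeta>
    unfolding I_def by (intro continuous_intros indefinite_integral_continuous_1 i)
  have G: "G \<zeta> \<in> bcontfun" for \<zeta>
  proof -
    have "continuous_on UNIV (G \<zeta>)" unfolding G_def Let_def
      by (rule continuous_on_compose2[OF cG0]) (use T in \<open>auto intro!: continuous_intros\<close>)
    moreover have "range (G \<zeta>) \<subseteq> (\<lambda>x. exp (- (2 * L * x)) * (y0 + I \<zeta> x)) ` {0..T}"
      using T by (auto simp: G_def Let_def)
    then have "bounded (range (G \<zeta>))"
      using compact_imp_bounded[OF compact_continuous_image[OF cG0]] bounded_subset by blast
    ultimately show ?thesis by (simp add: bcontfun_def)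
  qed
  have contr: "dist (Bcontfun (G \<zeta>)) (Bcontfun (G \<xi>)) \<le> 1 / 2 * dist \<zeta> \<xi>" for \<zeta> \<xi>
  proof (rule dist_bound)
    fix t
    define x where "x = min (max 0 t) T"
    have x: "0 \<le> x" using T by (simp add: x_def)
    have dI: "((\<lambda>\<sigma>. exp (2 * L * \<sigma>) / 2 * dist \<zeta> \<xi>) has_vector_derivative L * exp (2 * L * \<sigma>) * dist \<zeta> \<xi>) (at \<sigma> within {0..x})" for \<sigma>
      unfolding has_real_derivative_iff_has_vector_derivative[symmetric]
      by (auto intro!: derivative_eq_intros)
    have hi: "((\<lambda>\<sigma>. L * exp (2 * L * \<sigma>) * dist \<zeta> \<xi>) has_integral (exp (2 * L * x) / 2 * dist \<zeta> \<xi> - exp (2 * L * 0) / 2 * dist \<zeta> \<xi>)) {0..x}"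
      by (rule fundamental_theorem_of_calculus[OF x dI])
    have "\<bar>I \<zeta> x - I \<xi> x\<bar> = norm (integral {0..x} (\<lambda>\<sigma>. f \<sigma> (exp (2 * L * \<sigma>) * apply_bcontfun \<zeta> \<sigma>) - f \<sigma> (exp (2 * L * \<sigma>) * apply_bcontfun \<xi> \<sigma>)))"
      unfolding I_def by (subst integral_diff[OF i i]) simp
    also have "\<dots> \<le> integral {0..x} (\<lambda>\<sigma>. L * exp (2 * L * \<sigma>) * dist \<zeta> \<xi>)"
    proof (rule integral_norm_bound_integral)
      show "(\<lambda>\<sigma>. f \<sigma> (exp (2 * L * \<sigma>) * apply_bcontfun \<zeta> \<sigma>) - f \<sigma> (exp (2 * L * \<sigma>) * apply_bcontfun \<xi> \<sigma>)) integrable_on {0..x}"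
        by (intro integrable_diff i)
      show "(\<lambda>\<sigma>. L * exp (2 * L * \<sigma>) * dist \<zeta> \<xi>) integrable_on {0..x}" using hi by blast
      fix \<sigma>
      have "\<bar>f \<sigma> (exp (2 * L * \<sigma>) * apply_bcontfun \<zeta> \<sigma>) - f \<sigma> (exp (2 * L * \<sigma>) * apply_bcontfun \<xi> \<sigma>)\<bar>
          \<le> L * \<bar>exp (2 * L * \<sigma>) * apply_bcontfun \<zeta> \<sigma> - exp (2 * L * \<sigma>) * apply_bcontfun \<xi> \<sigma>\<bar>"
        by (rule lip)
      also have "\<dots> = L * exp (2 * L * \<sigma>) * dist (apply_bcontfun \<zeta> \<sigma>) (apply_bcontfun \<xi> \<sigma>)"
        by (simp add: right_diff_distrib[symmetric] abs_mult dist_real_def)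
      also have "\<dots> \<le> L * exp (2 * L * \<sigma>) * dist \<zeta> \<xi>"
        using L by (intro mult_left_mono dist_bounded) auto
      finally show "norm (f \<sigma> (exp (2 * L * \<sigma>) * apply_bcontfun \<zeta> \<sigma>) - f \<sigma> (exp (2 * L * \<sigma>) * apply_bcontfun \<xi> \<sigma>)) \<le> L * exp (2 * L * \<sigma>) * dist \<zeta> \<xi>"
        by simp
    qed
    also have "\<dots> \<le> exp (2 * L * x) / 2 * dist \<zeta> \<xi>"
      using integral_unique[OF hi] by simp
    finally have le: "\<bar>I \<zeta> x - I \<xi> x\<bar> \<le> exp (2 * L * x) / 2 * dist \<zeta> \<xi>" .
    have "dist (G \<zeta> t) (G \<xi> t) = exp (- (2 * L * x)) * \<bar>I \<zeta> x - I \<xi> x\<bar>"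
      by (simp add: G_def Let_def x_def[symmetric] dist_real_def right_diff_distrib[symmetric] abs_mult)
    also have "\<dots> \<le> exp (- (2 * L * x)) * (exp (2 * L * x) / 2 * dist \<zeta> \<xi>)"
      by (intro mult_left_mono le) auto
    also have "\<dots> = 1 / 2 * dist \<zeta> \<xi>" by (simp add: exp_minus field_simps)
    finally show "dist (apply_bcontfun (Bcontfun (G \<zeta>)) t) (apply_bcontfun (Bcontfun (G \<xi>)) t) \<le> 1 / 2 * dist \<zeta> \<xi>"
      by (simp add: Bcontfun_inverse G)
  qed
  obtain \<zeta> where "Bcontfun (G \<zeta>) = \<zeta>"
    using banach_fix_type[of "1 / 2" "\<lambda>\<zeta>. Bcontfun (G \<zeta>)"] contr by auto
  then have fp: "apply_bcontfun \<zeta> t = G \<zeta> t" for t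
    using Bcontfun_inverse[OF G] by metis
  define y where "y t = exp (2 * L * t) * apply_bcontfun \<zeta> t" for t
  have y: "y t = y0 + integral {0..t} (\<lambda>\<sigma>. f \<sigma> (y \<sigma>))" if "t \<in> {0..T}" for t
  proof -
    have "y t = exp (2 * L * t) * (exp (- (2 * L * t)) * (y0 + I \<zeta> t))"
      using that unfolding y_def fp by (simp add: G_def Let_def)
    then show ?thesis by (simp add: exp_minus I_def y_def)
  qed
  show thesis
  proof
    show "y 0 = y0" using y[of 0] T by simp
    fix t assume t: "t \<in> {0..T}"
    have "((\<lambda>t. integral {0..t} (\<lambda>\<sigma>. f \<sigma> (y \<sigma>))) has_real_derivative f t (y t)) (at t within {0..T})"
      using c[of "{0..T}" \<zeta>] t by (intro integral_has_real_derivative) (auto simp: y_def)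
    then have "((\<lambda>t. y0 + integral {0..t} (\<lambda>\<sigma>. f \<sigma> (y \<sigma>))) has_real_derivative f t (y t)) (at t within {0..T})"
      by (auto intro!: derivative_eq_intros)
    then show "(y has_real_derivative f t (y t)) (at t within {0..T})"
      unfolding has_real_derivative_iff_has_vector_derivative
      by (rule has_vector_derivative_transform[OF t, rotated]) (rule y)
  qed
qed

subsection \<open>Linearisation\<close>

text \<open>The integral of the part of the equation that does not depend on \<theta>; subtracting
  it leaves only the term with \<open>cos \<theta>\<close>.\<close>

definition phase :: "int \<Rightarrow> real \<Rightarrow> real \<Rightarrow> real" where
  "phase l s t = of_int l * t + s * sin t"

text \<open>The Riccati equation of \<open>cis (\<theta> t - phase l s t) = u t / v t\<close> in linear form.\<close>

definition josephson_linear :: "int \<Rightarrow> real \<Rightarrow> real \<Rightarrow> (real \<Rightarrow> complex) \<Rightarrow> (real \<Rightarrow> complex) \<Rightarrow> bool" where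
  "josephson_linear l a s u v \<longleftrightarrow> (\<forall>t\<in>{0..2*pi}.
     (u has_vector_derivative \<i> * of_real a / 2 * cis (- phase l s t) * v t) (at t within {0..2*pi}) \<and>
     (v has_vector_derivative - (\<i> * of_real a / 2) * cis (phase l s t) * u t) (at t within {0..2*pi}))"

lemma has_vector_derivative_cis:
  assumes "(g has_real_derivative d) (at t within S)"
  shows "((\<lambda>t. cis (g t)) has_vector_derivative \<i> * of_real d * cis (g t)) (at t within S)"
  using has_derivative_cis[OF assms[unfolded has_field_derivative_def]]
  by (simp add: has_vector_derivative_def scaleR_conv_of_real mult_ac)

lemma phase_derivative:
  "(phase l s has_real_derivative of_int l + s * cos t) (at t within S)"
  unfolding phase_def[abs_def] by (auto intro!: derivative_eq_intros)

lemma continuous_on_phase: "continuous_on S (phase l s)"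
  unfolding phase_def[abs_def] by (intro continuous_intros)

lemma phase_0 [simp]: "phase l s 0 = 0"
  by (simp add: phase_def)

lemma cis_phase_2pi: "cis (phase l s (2*pi)) = 1" "cis (- phase l s (2*pi)) = 1"
  using cis_multiple_2pi[of "of_int l"] cis_multiple_2pi[of "of_int (- l)"]
  by (simp_all add: phase_def mult_ac)

text \<open>Given \<theta>, the equation for \<open>v\<close> becomes scalar and is solved by an
  exponential, which never vanishes; \<open>u\<close> is then forced by the ratio.\<close>

lemma josephson_linearisation:
  assumes sol: "josephson_solution l a s \<theta>"
  obtains u v where "josephson_linear l a s u v" "v 0 = 1" "\<And>t. v t \<noteq> 0"
    "\<And>t. u t = cis (\<theta> t - phase l s t) * v t"
proof -
  let ?I = "{0..2*pi}"
  have d\<theta>: "(\<theta> has_real_derivative a * cos (\<theta> t) + of_int l + s * cos t) (at t within ?I)" if "t \<in> ?I" for t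
    using sol that by (auto simp: josephson_solution_def)
  have c\<theta>: "continuous_on ?I \<theta>"
    by (rule DERIV_continuous_on[OF d\<theta>])
  define A where "A t = integral {0..t} (\<lambda>t. cis (\<theta> t))" for t
  define v where "v t = exp (- (\<i> * of_real a / 2) * A t)" for t
  define u where "u t = cis (\<theta> t - phase l s t) * v t" for t
  have dA: "(A has_vector_derivative cis (\<theta> t)) (at t within ?I)" if "t \<in> ?I" for t
    unfolding A_def[abs_def] by (intro integral_has_vector_derivative continuous_intros c\<theta> that)
  have dv: "(v has_vector_derivative - (\<i> * of_real a / 2) * cis (\<theta> t) * v t) (at t within ?I)" if "t \<in> ?I" for t
  proof -
    have "((exp \<circ> (\<lambda>t. - (\<i> * of_real a / 2) * A t)) has_vector_derivative
        (- (\<i> * of_real a / 2) * cis (\<theta> t)) * exp (- (\<i> * of_real a / 2) * A t)) (at t within ?I)"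
      by (rule field_vector_diff_chain_within)
        (auto intro!: derivative_eq_intros dA that)
    then show ?thesis by (simp add: v_def[abs_def] o_def)
  qed
  have "josephson_linear l a s u v"
    unfolding josephson_linear_def
  proof (intro ballI conjI)
    fix t assume t: "t \<in> ?I"
    have w: "cis (phase l s t) * u t = cis (\<theta> t) * v t"
      by (simp add: u_def mult.assoc[symmetric] cis_mult)
    show "(v has_vector_derivative - (\<i> * of_real a / 2) * cis (phase l s t) * u t) (at t within ?I)"
      using dv[OF t] unfolding mult.assoc w .
    have dc: "((\<lambda>t. cis (\<theta> t - phase l s t)) has_vector_derivative
        \<i> * of_real (a * cos (\<theta> t)) * cis (\<theta> t - phase l s t)) (at t within ?I)"
      using has_vector_derivative_cis[OF DERIV_diff[OF d\<theta>[OF t] phase_derivative[of l s]]] by simp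
    have "(u has_vector_derivative cis (\<theta> t - phase l s t) * (- (\<i> * of_real a / 2) * cis (\<theta> t) * v t)
        + \<i> * of_real (a * cos (\<theta> t)) * cis (\<theta> t - phase l s t) * v t) (at t within ?I)"
      unfolding u_def[abs_def] by (rule has_vector_derivative_mult[OF dc dv[OF t]])
    also have "cis (\<theta> t - phase l s t) * (- (\<i> * of_real a / 2) * cis (\<theta> t) * v t)
        + \<i> * of_real (a * cos (\<theta> t)) * cis (\<theta> t - phase l s t) * v t
      = \<i> * of_real a / 2 * (cis (\<theta> t - phase l s t) * (2 * of_real (cos (\<theta> t)) - cis (\<theta> t))) * v t"
      by (simp add: algebra_simps)
    \<comment> \<open>This identity removes \<theta> from the equation for \<open>u\<close>, leaving
      only the phase factor.\<close>
    also have "2 * of_real (cos (\<theta> t)) - cis (\<theta> t) = cis (- \<theta> t)"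
      by (simp add: complex_eq_iff)
    also have "cis (\<theta> t - phase l s t) * cis (- \<theta> t) = cis (- phase l s t)"
      by (simp add: cis_mult)
    finally show "(u has_vector_derivative \<i> * of_real a / 2 * cis (- phase l s t) * v t) (at t within ?I)" .
  qed
  moreover have "v 0 = 1" by (simp add: v_def A_def)
  moreover have "v t \<noteq> 0" for t by (simp add: v_def)
  ultimately show thesis using that u_def by blast
qed

text \<open>The coefficient matrix of the linear system has zero diagonal, hence trace 0.\<close>

lemma josephson_wronskian:
  assumes 1: "josephson_linear l a s u1 v1" and 2: "josephson_linear l a s u2 v2"
  shows "u1 (2*pi) * v2 (2*pi) - u2 (2*pi) * v1 (2*pi) = u1 0 * v2 0 - u2 0 * v1 0"
proof -
  have "\<exists>c. \<forall>t\<in>{0..2*pi}. u1 t * v2 t - u2 t * v1 t = c"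
  proof (rule has_derivative_zero_constant)
    fix t :: real assume t: "t \<in> {0..2*pi}"
    have "((\<lambda>t. u1 t * v2 t - u2 t * v1 t) has_vector_derivative
       (u1 t * (- (\<i> * of_real a / 2) * cis (phase l s t) * u2 t) + (\<i> * of_real a / 2 * cis (- phase l s t) * v1 t) * v2 t)
       - (u2 t * (- (\<i> * of_real a / 2) * cis (phase l s t) * u1 t) + (\<i> * of_real a / 2 * cis (- phase l s t) * v2 t) * v1 t))
       (at t within {0..2*pi})"
      using 1 2 t unfolding josephson_linear_def
      by (intro has_vector_derivative_diff has_vector_derivative_mult) auto
    then show "((\<lambda>t. u1 t * v2 t - u2 t * v1 t) has_derivative (\<lambda>h. 0)) (at t within {0..2*pi})"
      by (simp add: has_vector_derivative_def algebra_simps)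
  qed simp
  then show ?thesis by fastforce
qed

section \<open>The flow map and the monodromy of the linear system\<close>

lemma josephson_solution_exists:
  assumes "0 < a"
  obtains \<theta> where "josephson_solution l a s \<theta>" "\<theta> 0 = \<theta>0"
proof -
  have lip: "\<bar>(a * cos y + of_int l + s * cos t) - (a * cos z + of_int l + s * cos t)\<bar> \<le> a * \<bar>y - z\<bar>" for t y z
  proof -
    have "\<bar>cos y - cos z\<bar> \<le> \<bar>y - z\<bar>"
    proof -
      have "\<bar>cos y - cos z\<bar> = 2 * \<bar>sin ((y + z) / 2)\<bar> * \<bar>sin ((z - y) / 2)\<bar>"
        by (simp add: cos_diff_cos abs_mult)
      also have "\<dots> \<le> 2 * 1 * \<bar>(z - y) / 2\<bar>"
        by (intro mult_mono abs_sin_x_le_abs_x) auto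
      finally show ?thesis by simp
    qed
    then have "a * \<bar>cos y - cos z\<bar> \<le> a * \<bar>y - z\<bar>" using assms by (intro mult_left_mono) auto
    then show ?thesis using assms by (simp add: right_diff_distrib[symmetric] abs_mult)
  qed
  have cont: "continuous_on UNIV (\<lambda>p. a * cos (snd p) + of_int l + s * cos (fst p))"
    by (intro continuous_intros)
  obtain \<theta> where "\<theta> 0 = \<theta>0" "\<And>t. t \<in> {0..2*pi} \<Longrightarrow>
      (\<theta> has_real_derivative a * cos (\<theta> t) + of_int l + s * cos t) (at t within {0..2*pi})"
    using lipschitz_ode_exists[OF cont lip assms, of "2*pi" \<theta>0] by auto
  then show thesis by (intro that[of \<theta>]) (auto simp: josephson_solution_def)
qed

text \<open>The description defining \<open>flow_map\<close> is proper: solutions with equal initial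
  phase have Wronskian 0, also at \<open>2*pi\<close>, where nonzero denominators make the ratios
  equal.\<close>

lemma flow_map_eq:
  assumes "josephson_solution l a s \<theta>"
  shows "flow_map l a s (cis (\<theta> 0)) = cis (\<theta> (2*pi))"
  unfolding flow_map_def
proof (rule the_equality)
  show "\<exists>\<theta>'. josephson_solution l a s \<theta>' \<and> cis (\<theta>' 0) = cis (\<theta> 0) \<and> cis (\<theta>' (2*pi)) = cis (\<theta> (2*pi))"
    using assms by blast
next
  fix w assume "\<exists>\<theta>'. josephson_solution l a s \<theta>' \<and> cis (\<theta>' 0) = cis (\<theta> 0) \<and> cis (\<theta>' (2*pi)) = w"
  then obtain \<theta>' where \<theta>': "josephson_solution l a s \<theta>'" "cis (\<theta>' 0) = cis (\<theta> 0)" "cis (\<theta>' (2*pi)) = w" by blast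
  obtain u v where uv: "josephson_linear l a s u v" "v 0 = 1" "\<And>t. v t \<noteq> 0"
    "\<And>t. u t = cis (\<theta> t - phase l s t) * v t" using josephson_linearisation[OF assms] by metis
  obtain u' v' where uv': "josephson_linear l a s u' v'" "v' 0 = 1" "\<And>t. v' t \<noteq> 0"
    "\<And>t. u' t = cis (\<theta>' t - phase l s t) * v' t" using josephson_linearisation[OF \<theta>'(1)] by metis
  have "(cis (\<theta> (2*pi)) - w) * (v (2*pi) * v' (2*pi)) = 0"
    using josephson_wronskian[OF uv(1) uv'(1)] uv(2) uv'(2) \<theta>'(2,3)
    unfolding uv(4) uv'(4) by (simp add: cis_divide[symmetric] cis_phase_2pi algebra_simps)
  then show "w = cis (\<theta> (2*pi))" using uv(3) uv'(3) by simp
qed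

text \<open>A fixed point \<open>z\<close> of the flow map is an eigendirection
  \<open>(z, 1)\<close> of the monodromy matrix, with eigenvalue \<open>v (2*pi)\<close>.\<close>

lemma Constr_multiplier:
  assumes C: "(a, s) \<in> Constr l" and z: "z \<in> sphere 0 1"
  obtains u v where "josephson_linear l a s u v" "u 0 = z" "v 0 = 1" "u (2*pi) = z * v (2*pi)" "v (2*pi) \<noteq> 0"
proof -
  obtain \<theta>0 where \<theta>0: "cis \<theta>0 = z"
    using z complex_norm_eq_1_exp[of z] by (auto simp: cis_conv_exp)
  obtain \<theta> where \<theta>: "josephson_solution l a s \<theta>" "\<theta> 0 = \<theta>0"
    using josephson_solution_exists[of a l s \<theta>0] C by (auto simp: Constr_def)
  have "cis (\<theta> (2*pi)) = z"
    using flow_map_eq[OF \<theta>(1)] C z \<theta>(2) \<theta>0 by (auto simp: Constr_def)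
  moreover obtain u v where uv: "josephson_linear l a s u v" "v 0 = 1" "\<And>t. v t \<noteq> 0"
    "\<And>t. u t = cis (\<theta> t - phase l s t) * v t" using josephson_linearisation[OF \<theta>(1)] by metis
  ultimately have "u 0 = z" "u (2*pi) = z * v (2*pi)"
    using \<theta>(2) \<theta>0 unfolding uv(4) by (simp_all add: uv(2) cis_divide[symmetric] cis_phase_2pi)
  with uv that show thesis by blast
qed

text \<open>By conservation of the Wronskian, the eigenvalues of any two of the directions 1, - 1
  and \<open>\<i>\<close> have product 1; the three relations force equal eigenvalues of square
  1.\<close>

lemma Constr_fundamental_solutions:
  assumes C: "(a, s) \<in> Constr l"
  obtains \<mu> u1 v1 u2 v2 where "\<mu> = 1 \<or> \<mu> = - 1"
    "josephson_linear l a s u1 v1" "u1 0 = 1" "v1 0 = 1" "u1 (2*pi) = \<mu>" "v1 (2*pi) = \<mu>"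
    "josephson_linear l a s u2 v2" "u2 0 = - 1" "v2 0 = 1" "u2 (2*pi) = - \<mu>" "v2 (2*pi) = \<mu>"
proof -
  obtain u1 v1 where 1: "josephson_linear l a s u1 v1" "u1 0 = 1" "v1 0 = 1" "u1 (2*pi) = 1 * v1 (2*pi)" "v1 (2*pi) \<noteq> 0"
    by (rule Constr_multiplier[OF C, of 1]) auto
  obtain u2 v2 where 2: "josephson_linear l a s u2 v2" "u2 0 = - 1" "v2 0 = 1" "u2 (2*pi) = - 1 * v2 (2*pi)" "v2 (2*pi) \<noteq> 0"
    by (rule Constr_multiplier[OF C, of "- 1"]) auto
  obtain u3 v3 where 3: "josephson_linear l a s u3 v3" "u3 0 = \<i>" "v3 0 = 1" "u3 (2*pi) = \<i> * v3 (2*pi)" "v3 (2*pi) \<noteq> 0"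
    by (rule Constr_multiplier[OF C, of \<i>]) auto
  have "v1 (2*pi) * v2 (2*pi) = 1"
    using josephson_wronskian[OF 1(1) 2(1)] unfolding 1(2-4) 2(2-4) by (simp add: algebra_simps)
  moreover have "(1 - \<i>) * (v1 (2*pi) * v3 (2*pi)) = (1 - \<i>) * 1"
    using josephson_wronskian[OF 1(1) 3(1)] unfolding 1(2-4) 3(2-4) by (simp add: algebra_simps)
  then have "v1 (2*pi) * v3 (2*pi) = 1"
    by (subst (asm) mult_cancel_left) (auto simp: complex_eq_iff)
  moreover have "(1 + \<i>) * (v2 (2*pi) * v3 (2*pi)) = (1 + \<i>) * 1"
  proof -
    have "- 1 * v2 (2*pi) * v3 (2*pi) - \<i> * v3 (2*pi) * v2 (2*pi) = - 1 * 1 - \<i> * 1"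
      using josephson_wronskian[OF 2(1) 3(1)] unfolding 2(2-4) 3(2-4) .
    moreover have "(1 + \<i>) * (v2 (2*pi) * v3 (2*pi)) = - (- 1 * v2 (2*pi) * v3 (2*pi) - \<i> * v3 (2*pi) * v2 (2*pi))"
      by (simp add: algebra_simps)
    ultimately show ?thesis by (simp only:) simp
  qed
  then have "v2 (2*pi) * v3 (2*pi) = 1"
    by (subst (asm) mult_cancel_left) (auto simp: complex_eq_iff)
  ultimately have e: "v1 (2*pi) = v2 (2*pi)" "v1 (2*pi) * v1 (2*pi) = 1"
    by (metis mult.commute mult.right_neutral mult.assoc)+
  then have "v1 (2*pi) = 1 \<or> v1 (2*pi) = - 1"
    by (simp add: square_eq_1_iff)
  with 1 2 e(1) that show thesis by simp
qed

lemma josephson_linear_combination: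
  assumes "josephson_linear l a s u1 v1" "josephson_linear l a s u2 v2"
  shows "josephson_linear l a s (\<lambda>t. c * u1 t + d * u2 t) (\<lambda>t. c * v1 t + d * v2 t)"
  unfolding josephson_linear_def
proof (intro ballI conjI)
  fix t assume t: "t \<in> {0..2*pi}"
  let ?F = "at t within {0..2*pi}"
  have "((\<lambda>t. c * u1 t + d * u2 t) has_vector_derivative
      c * (\<i> * of_real a / 2 * cis (- phase l s t) * v1 t) + d * (\<i> * of_real a / 2 * cis (- phase l s t) * v2 t)) ?F"
    using assms t unfolding josephson_linear_def
    by (intro has_vector_derivative_add has_vector_derivative_mult_right) auto
  then show "((\<lambda>t. c * u1 t + d * u2 t) has_vector_derivative
      \<i> * of_real a / 2 * cis (- phase l s t) * (c * v1 t + d * v2 t)) ?F"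
    by (simp add: algebra_simps add_divide_distrib)
  have "((\<lambda>t. c * v1 t + d * v2 t) has_vector_derivative
      c * (- (\<i> * of_real a / 2) * cis (phase l s t) * u1 t) + d * (- (\<i> * of_real a / 2) * cis (phase l s t) * u2 t)) ?F"
    using assms t unfolding josephson_linear_def
    by (intro has_vector_derivative_add has_vector_derivative_mult_right) auto
  then show "((\<lambda>t. c * v1 t + d * v2 t) has_vector_derivative
      - (\<i> * of_real a / 2) * cis (phase l s t) * (c * u1 t + d * u2 t)) ?F"
    by (simp add: algebra_simps add_divide_distrib)
qed

section \<open>Fourier coefficients at real frequencies\<close>

definition fcoef :: "(real \<Rightarrow> complex) \<Rightarrow> real \<Rightarrow> complex" where
  "fcoef f \<nu> = integral {0..2*pi} (\<lambda>t. f t * cis (- (\<nu> * t)))"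

lemma has_integral_fcoef:
  assumes "continuous_on {0..2*pi} f"
  shows "((\<lambda>t. f t * cis (- (\<nu> * t))) has_integral fcoef f \<nu>) {0..2*pi}"
  unfolding fcoef_def
  by (intro integrable_integral integrable_continuous_interval continuous_intros assms)

lemma fcoef_linear_combination:
  assumes "continuous_on {0..2*pi} f" "continuous_on {0..2*pi} g"
  shows "fcoef (\<lambda>t. c * f t + d * g t) \<nu> = c * fcoef f \<nu> + d * fcoef g \<nu>"
proof -
  have "(c * f t + d * g t) * cis (- (\<nu> * t)) = c * (f t * cis (- (\<nu> * t))) + d * (g t * cis (- (\<nu> * t)))" for t
    by (simp add: algebra_simps)
  then show ?thesis
    unfolding fcoef_def by (simp only:) (intro integral_linear_combination continuous_intros assms)
qed

lemma cis_2pi_cancel: "cis (2 * pi * \<nu>) * z * cis (- (\<nu> * (2 * pi))) = z"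
  by (simp add: mult.assoc mult.left_commute[of _ z] cis_mult mult.commute[of \<nu>])

lemma fcoef_bounded:
  assumes "continuous_on {0..2*pi} f"
  obtains B where "\<And>\<nu>. norm (fcoef f \<nu>) \<le> B"
proof -
  obtain B where B: "\<And>t. t \<in> {0..2*pi} \<Longrightarrow> norm (f t) \<le> B"
    using compact_imp_bounded[OF compact_continuous_image[OF assms compact_Icc]]
    unfolding bounded_iff by blast
  have "norm (fcoef f \<nu>) \<le> B * (2 * pi - 0)" for \<nu>
    unfolding fcoef_def
    by (rule integral_bound) (auto intro!: continuous_intros assms B simp: norm_mult)
  with that show thesis .
qed

text \<open>Integration by parts; \<open>per\<close> makes \<open>f t * cis (- (\<nu> * t))\<close>
  equal at both ends, so the boundary term drops out.\<close>

lemma fcoef_derivative: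
  assumes f: "\<And>t. t \<in> {0..2*pi} \<Longrightarrow> (f has_vector_derivative f' t) (at t within {0..2*pi})"
    and f': "continuous_on {0..2*pi} f'"
    and per: "f (2*pi) = cis (2 * pi * \<nu>) * f 0"
  shows "fcoef f' \<nu> = \<i> * of_real \<nu> * fcoef f \<nu>"
proof -
  have cf: "continuous_on {0..2*pi} f"
    by (rule continuous_on_vector_derivative[OF f])
  have d: "((\<lambda>t. f t * cis (- (\<nu> * t))) has_vector_derivative
      f t * (\<i> * of_real (- \<nu>) * cis (- (\<nu> * t))) + f' t * cis (- (\<nu> * t))) (at t within {0..2*pi})"
    if "t \<in> {0..2*pi}" for t
    by (intro has_vector_derivative_mult f that has_vector_derivative_cis) (auto intro!: derivative_eq_intros)
  have "((\<lambda>t. f t * (\<i> * of_real (- \<nu>) * cis (- (\<nu> * t))) + f' t * cis (- (\<nu> * t))) has_integral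
      f (2*pi) * cis (- (\<nu> * (2*pi))) - f 0 * cis (- (\<nu> * 0))) {0..2*pi}"
    by (rule fundamental_theorem_of_calculus[OF _ d]) auto
  moreover have "f (2*pi) * cis (- (\<nu> * (2*pi))) - f 0 * cis (- (\<nu> * 0)) = 0"
    unfolding per cis_2pi_cancel by simp
  moreover have "f t * (\<i> * of_real (- \<nu>) * cis (- (\<nu> * t))) + f' t * cis (- (\<nu> * t))
      = f' t * cis (- (\<nu> * t)) - (\<i> * of_real \<nu>) * (f t * cis (- (\<nu> * t)))" for t
    by simp
  ultimately have h0: "((\<lambda>t. f' t * cis (- (\<nu> * t)) - (\<i> * of_real \<nu>) * (f t * cis (- (\<nu> * t)))) has_integral 0) {0..2*pi}"
    by (simp only:)
  have "((\<lambda>t. f' t * cis (- (\<nu> * t)) - (\<i> * of_real \<nu>) * (f t * cis (- (\<nu> * t))))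
      has_integral fcoef f' \<nu> - (\<i> * of_real \<nu>) * fcoef f \<nu>) {0..2*pi}"
    by (intro has_integral_diff has_integral_mult_right has_integral_fcoef f' cf)
  from has_integral_unique[OF this h0] show ?thesis by simp
qed

text \<open>The factor \<open>cis (- (\<kappa> * t))\<close> turns \<open>f\<close> into a periodic
  function, to which Fourier uniqueness applies.\<close>

lemma fcoef_zero_imp_initial_zero:
  assumes f: "continuous_on {0..2*pi} f" and per: "f (2*pi) = cis (2 * pi * \<kappa>) * f 0"
    and zero: "\<And>n::int. fcoef f (of_int n + \<kappa>) = 0"
  shows "f 0 = 0"
proof -
  define g where "g t = f t * cis (- (\<kappa> * t))" for t
  have "g 0 = 0"
  proof (rule Fourier_coefficients_zero_imp_zero)
    show "continuous_on {0..2*pi} g"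
      unfolding g_def[abs_def] by (intro continuous_intros f)
    show "g (2*pi) = g 0"
      unfolding g_def per cis_2pi_cancel by simp
    fix n :: int
    have "g t * cis (of_int n * t) = f t * cis (- ((of_int (- n) + \<kappa>) * t))" for t
      by (simp add: g_def mult.assoc cis_mult algebra_simps)
    then show "integral {0..2*pi} (\<lambda>t. g t * cis (of_int n * t)) = 0"
      using zero[of "- n"] by (simp add: fcoef_def)
  qed simp
  then show ?thesis by (simp add: g_def)
qed

text \<open>For a solution \<open>(u, v)\<close> this is the derivative of \<open>u\<close>; its
  mean vanishes when \<open>u\<close> is periodic.\<close>

definition velocity :: "int \<Rightarrow> real \<Rightarrow> real \<Rightarrow> (real \<Rightarrow> complex) \<Rightarrow> real \<Rightarrow> complex" where
  "velocity l a s v t = \<i> * of_real a / 2 * cis (- phase l s t) * v t"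

lemma velocity_linear_combination:
  "velocity l a s (\<lambda>t. c * v1 t + d * v2 t) = (\<lambda>t. c * velocity l a s v1 t + d * velocity l a s v2 t)"
  by (simp add: velocity_def fun_eq_iff algebra_simps add_divide_distrib)

lemma josephson_linear_continuous:
  assumes "josephson_linear l a s u v"
  shows "continuous_on {0..2*pi} u" "continuous_on {0..2*pi} v" "continuous_on {0..2*pi} (velocity l a s v)"
proof -
  show "continuous_on {0..2*pi} u"
    by (rule continuous_on_vector_derivative) (use assms in \<open>auto simp: josephson_linear_def\<close>)
  show v: "continuous_on {0..2*pi} v"
    by (rule continuous_on_vector_derivative) (use assms in \<open>auto simp: josephson_linear_def\<close>)
  show "continuous_on {0..2*pi} (velocity l a s v)"
    unfolding velocity_def[abs_def] by (intro continuous_intros v continuous_on_phase)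
qed

lemma velocity_derivative:
  assumes lin: "josephson_linear l a s u v" and t: "t \<in> {0..2*pi}"
  shows "(velocity l a s v has_vector_derivative
    of_real (a\<^sup>2 / 4) * u t - \<i> * of_real (of_int l + s * cos t) * velocity l a s v t) (at t within {0..2*pi})"
proof -
  have dv: "(v has_vector_derivative - (\<i> * of_real a / 2) * cis (phase l s t) * u t) (at t within {0..2*pi})"
    using lin t by (auto simp: josephson_linear_def)
  have "(velocity l a s v has_vector_derivative
      \<i> * of_real a / 2 * (cis (- phase l s t) * (- (\<i> * of_real a / 2) * cis (phase l s t) * u t)
        + \<i> * of_real (- (of_int l + s * cos t)) * cis (- phase l s t) * v t)) (at t within {0..2*pi})"
    unfolding velocity_def[abs_def] mult.assoc[of "\<i> * of_real a / 2"]
    by (intro has_vector_derivative_mult_right has_vector_derivative_mult dv has_vector_derivative_cis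
      DERIV_minus phase_derivative)
  also have "\<i> * of_real a / 2 * (cis (- phase l s t) * (- (\<i> * of_real a / 2) * cis (phase l s t) * u t)
        + \<i> * of_real (- (of_int l + s * cos t)) * cis (- phase l s t) * v t)
      = of_real (a\<^sup>2 / 4) * (cis (- phase l s t) * cis (phase l s t)) * u t - \<i> * of_real (of_int l + s * cos t) * velocity l a s v t"
    by (simp add: velocity_def algebra_simps power2_eq_square add_divide_distrib diff_divide_distrib)
  also have "cis (- phase l s t) * cis (phase l s t) = 1" by (simp add: cis_mult)
  finally show ?thesis by simp
qed

text \<open>Fourier coefficients of the equations for the derivatives of \<open>u\<close> and of the
  velocity; the factor \<open>cos t\<close> couples each frequency to its two neighbours.\<close>

lemma velocity_coefficients:
  assumes lin: "josephson_linear l a s u v"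
    and \<mu>: "u (2*pi) = cis (2 * pi * \<nu>) * u 0" "v (2*pi) = cis (2 * pi * \<nu>) * v 0"
  defines "P \<equiv> fcoef (velocity l a s v)"
  shows "P \<nu> = \<i> * of_real \<nu> * fcoef u \<nu>"
    and "\<i> * of_real \<nu> * P \<nu> = of_real (a\<^sup>2 / 4) * fcoef u \<nu>
      - \<i> * (of_int l * P \<nu> + of_real (s / 2) * (P (\<nu> - 1) + P (\<nu> + 1)))"
proof -
  note c = josephson_linear_continuous[OF lin]
  show "P \<nu> = \<i> * of_real \<nu> * fcoef u \<nu>"
    unfolding P_def
    by (rule fcoef_derivative) (use lin c \<mu> in \<open>auto simp: josephson_linear_def velocity_def\<close>)
  let ?p' = "\<lambda>t. of_real (a\<^sup>2 / 4) * u t - \<i> * of_real (of_int l + s * cos t) * velocity l a s v t"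
  have c': "continuous_on {0..2*pi} ?p'"
    by (intro continuous_intros c)
  have "fcoef ?p' \<nu> = \<i> * of_real \<nu> * P \<nu>"
    unfolding P_def
  proof (rule fcoef_derivative[OF velocity_derivative[OF lin] c'])
    show "velocity l a s v (2*pi) = cis (2 * pi * \<nu>) * velocity l a s v 0"
      by (simp add: velocity_def \<mu> cis_phase_2pi)
  qed
  moreover have "((\<lambda>t. of_real (a\<^sup>2 / 4) * (u t * cis (- (\<nu> * t)))
      - \<i> * (of_int l * (velocity l a s v t * cis (- (\<nu> * t))) + of_real (s / 2) *
        (velocity l a s v t * cis (- ((\<nu> - 1) * t)) + velocity l a s v t * cis (- ((\<nu> + 1) * t)))))
      has_integral of_real (a\<^sup>2 / 4) * fcoef u \<nu>
      - \<i> * (of_int l * P \<nu> + of_real (s / 2) * (P (\<nu> - 1) + P (\<nu> + 1)))) {0..2*pi}"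
    unfolding P_def
    by (intro has_integral_diff has_integral_mult_right has_integral_add has_integral_fcoef c)
  moreover have "of_real (a\<^sup>2 / 4) * (u t * cis (- (\<nu> * t)))
      - \<i> * (of_int l * (velocity l a s v t * cis (- (\<nu> * t))) + of_real (s / 2) *
        (velocity l a s v t * cis (- ((\<nu> - 1) * t)) + velocity l a s v t * cis (- ((\<nu> + 1) * t))))
      = ?p' t * cis (- (\<nu> * t))" for t
  proof -
    have "cis (- ((\<nu> - 1) * t)) = cis t * cis (- (\<nu> * t))" "cis (- ((\<nu> + 1) * t)) = cis (- t) * cis (- (\<nu> * t))"
      by (simp_all add: cis_mult algebra_simps)
    moreover have "complex_of_real (of_int l + s * cos t) = of_int l + of_real (s / 2) * (cis t + cis (- t))"
      by (simp add: complex_eq_iff)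
    ultimately show ?thesis by (simp only: ring_distribs mult_ac)
  qed
  ultimately show "\<i> * of_real \<nu> * P \<nu> = of_real (a\<^sup>2 / 4) * fcoef u \<nu>
      - \<i> * (of_int l * P \<nu> + of_real (s / 2) * (P (\<nu> - 1) + P (\<nu> + 1)))"
    using has_integral_unique[OF has_integral_fcoef[OF c', of \<nu>]] by simp
qed

subsection \<open>Fourier modes of periodic solutions\<close>

lemma three_term_zero:
  fixes f :: "int \<Rightarrow> complex"
  assumes rec: "\<And>n. k < n \<Longrightarrow> f (n + 1) = c n * f n - f (n - 1)"
    and 0: "f k = 0" "f (k + 1) = 0" and "k \<le> n"
  shows "f n = 0"
proof -
  have "f n = 0 \<and> f (n + 1) = 0"
    using \<open>k \<le> n\<close>
  proof (induction n rule: int_ge_induct)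
    case (step i)
    then show ?case using rec[of "i + 1"] by simp
  qed (use 0 in simp)
  then show ?thesis by simp
qed

text \<open>\<kappa> is a Floquet exponent; the cases used are 0 (periodic) and 1/2 (antiperiodic),
  with frequencies \<open>n + \<kappa>\<close>.\<close>

locale josephson_modes =
  fixes a s :: real and l :: int and \<kappa> :: real and u v :: "real \<Rightarrow> complex"
  assumes a: "0 < a" and s: "0 < s"
    and linear: "josephson_linear l a s u v"
    and multiplier: "u (2*pi) = cis (2 * pi * \<kappa>) * u 0" "v (2*pi) = cis (2 * pi * \<kappa>) * v 0"
begin

definition vcoef :: "int \<Rightarrow> complex" where
  "vcoef n = fcoef (velocity l a s v) (of_int n + \<kappa>)"

definition rec_coef :: "int \<Rightarrow> complex" where
  "rec_coef n = of_real (- (2 / s) * ((of_int n + \<kappa>) + of_int l + a\<^sup>2 / (4 * (of_int n + \<kappa>))))"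

lemma cis_shift: "cis (2 * pi * (of_int n + \<kappa>)) = cis (2 * pi * \<kappa>)"
  using cis_multiple_2pi[of "of_int n"] by (simp add: ring_distribs cis_mult[symmetric] del: cis_mult)

lemma coefficients:
  shows "vcoef n = \<i> * of_real (of_int n + \<kappa>) * fcoef u (of_int n + \<kappa>)"
    and "\<i> * of_real (of_int n + \<kappa>) * vcoef n = of_real (a\<^sup>2 / 4) * fcoef u (of_int n + \<kappa>)
      - \<i> * (of_int l * vcoef n + of_real (s / 2) * (vcoef (n - 1) + vcoef (n + 1)))"
proof -
  have e: "of_int (n - 1) + \<kappa> = of_int n + \<kappa> - 1" "of_int (n + 1) + \<kappa> = of_int n + \<kappa> + 1" by auto
  note vc = velocity_coefficients[OF linear multiplier[folded cis_shift[of n]]]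
  show "vcoef n = \<i> * of_real (of_int n + \<kappa>) * fcoef u (of_int n + \<kappa>)"
    unfolding vcoef_def by (rule vc(1))
  show "\<i> * of_real (of_int n + \<kappa>) * vcoef n = of_real (a\<^sup>2 / 4) * fcoef u (of_int n + \<kappa>)
      - \<i> * (of_int l * vcoef n + of_real (s / 2) * (vcoef (n - 1) + vcoef (n + 1)))"
    unfolding vcoef_def e by (rule vc(2))
qed

text \<open>Eliminating the coefficient of \<open>u\<close> takes a division by the frequency. For
  \<kappa> = 0 the link at index 0 is therefore missing, and with \<open>vcoef 0 = 0\<close> the two
  half-lines decouple.\<close>

lemma recurrence:
  assumes "of_int n + \<kappa> \<noteq> 0"
  shows "vcoef (n + 1) = rec_coef n * vcoef n - vcoef (n - 1)"
proof -
  define N where "N = complex_of_real (of_int n + \<kappa>)"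
  have N: "N \<noteq> 0" unfolding N_def using assms of_real_eq_0_iff by blast
  define U where "U = fcoef u (of_int n + \<kappa>)"
  have 1: "vcoef n = \<i> * N * U" and 2: "\<i> * N * vcoef n = of_real (a\<^sup>2 / 4) * U - \<i> * (of_int l * vcoef n + of_real (s / 2) * (vcoef (n - 1) + vcoef (n + 1)))"
    using coefficients[of n] by (simp_all only: N_def U_def)
  have "\<i> * (N * (N * vcoef n)) = N * (of_real (a\<^sup>2 / 4) * U) - \<i> * (N * (of_int l * vcoef n + of_real (s / 2) * (vcoef (n - 1) + vcoef (n + 1))))"
    using arg_cong[OF 2, of "\<lambda>x. N * x"] by (simp only: right_diff_distrib mult_ac)
  also have "N * (of_real (a\<^sup>2 / 4) * U) = - \<i> * (of_real (a\<^sup>2 / 4) * vcoef n)"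
    unfolding 1 by (simp add: mult_ac)
  finally have eq: "\<i> * (N * (N * vcoef n)) = - \<i> * (of_real (a\<^sup>2 / 4) * vcoef n)
      - \<i> * (N * (of_int l * vcoef n + of_real (s / 2) * (vcoef (n - 1) + vcoef (n + 1))))" .
  have cancel: "A + B + C = 0" if "\<i> * A = - \<i> * B - \<i> * C" for A B C
  proof -
    have "\<i> * (A + B + C) = 0" by (simp add: distrib_left that)
    then show ?thesis by simp
  qed
  have "N * (N * vcoef n) + of_real (a\<^sup>2 / 4) * vcoef n + N * (of_int l * vcoef n + of_real (s / 2) * (vcoef (n - 1) + vcoef (n + 1))) = 0"
    by (rule cancel[OF eq])
  then have "vcoef (n + 1) = - (2 / of_real s) * (N + of_int l + of_real (a\<^sup>2) / (4 * N)) * vcoef n - vcoef (n - 1)"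
    using N s by (simp add: field_simps power2_eq_square) (simp add: eq_neg_iff_add_eq_0 algebra_simps)
  then show ?thesis by (simp add: N_def rec_coef_def)
qed

lemma recurrence_downward:
  assumes "of_int (- n) + \<kappa> \<noteq> 0"
  shows "vcoef (- (n + 1)) = rec_coef (- n) * vcoef (- n) - vcoef (- (n - 1))"
proof -
  have i: "- n - 1 = - (n + 1)" "- n + 1 = - (n - 1)" by auto
  show ?thesis
    using recurrence[OF assms] unfolding i by (simp add: eq_diff_eq add.commute)
qed

lemma vcoef_bounded:
  obtains B where "\<And>n. norm (vcoef n) \<le> B"
  using fcoef_bounded[OF josephson_linear_continuous(3)[OF linear]] unfolding vcoef_def by metis

text \<open>The left side is the modulus of the left side of \<open>coefficients(2)\<close>, whose
  right side is a fixed combination of bounded coefficients.\<close>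

lemma vcoef_decay:
  obtains B where "\<And>n. \<bar>of_int n + \<kappa>\<bar> * norm (vcoef n) \<le> B"
proof -
  obtain B where B: "\<And>n. norm (vcoef n) \<le> B" using vcoef_bounded by blast
  obtain C where C: "\<And>\<nu>. norm (fcoef u \<nu>) \<le> C"
    using fcoef_bounded[OF josephson_linear_continuous(1)[OF linear]] by blast
  have "\<bar>of_int n + \<kappa>\<bar> * norm (vcoef n) \<le> a\<^sup>2 / 4 * C + (\<bar>of_int l\<bar> * B + s / 2 * (B + B))" for n
  proof -
    have "\<bar>of_int n + \<kappa>\<bar> * norm (vcoef n) = norm (\<i> * of_real (of_int n + \<kappa>) * vcoef n)"
      by (simp add: norm_mult del: of_real_add)
    also have "\<dots> \<le> norm (of_real (a\<^sup>2 / 4) * fcoef u (of_int n + \<kappa>))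
       + norm (\<i> * (of_int l * vcoef n + of_real (s / 2) * (vcoef (n - 1) + vcoef (n + 1))))"
      unfolding coefficients(2) by (rule norm_triangle_ineq4)
    also have "norm (of_real (a\<^sup>2 / 4) * fcoef u (of_int n + \<kappa>)) \<le> a\<^sup>2 / 4 * C"
      unfolding norm_mult norm_of_real using C by (intro mult_mono) auto
    also have "norm (\<i> * (of_int l * vcoef n + of_real (s / 2) * (vcoef (n - 1) + vcoef (n + 1))))
       \<le> norm (of_int l * vcoef n) + norm (complex_of_real (s / 2) * (vcoef (n - 1) + vcoef (n + 1)))"
      unfolding norm_mult[of \<i>] norm_ii mult_1 by (rule norm_triangle_ineq)
    also have "norm (of_int l * vcoef n) \<le> \<bar>of_int l\<bar> * B"
      unfolding norm_mult norm_of_int using B by (intro mult_left_mono) auto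
    also have "norm (complex_of_real (s / 2) * (vcoef (n - 1) + vcoef (n + 1))) \<le> s / 2 * (B + B)"
      unfolding norm_mult norm_of_real
      using s norm_triangle_le[OF add_mono[OF B B]] by (intro mult_mono) auto
    finally show ?thesis by simp
  qed
  with that show thesis by blast
qed

text \<open>Fourier uniqueness gives \<open>v 0 = 0\<close> through the velocity;
  \<open>coefficients(2)\<close> then leaves only the term in \<open>u\<close>, so
  \<open>a > 0\<close> makes the coefficients of \<open>u\<close> vanish too.\<close>

lemma vcoef_zero_imp_trivial:
  assumes zero: "\<And>n. vcoef n = 0"
  shows "u 0 = 0" "v 0 = 0"
proof -
  note c = josephson_linear_continuous[OF linear]
  have "velocity l a s v 0 = 0"
    by (rule fcoef_zero_imp_initial_zero[OF c(3), of \<kappa>])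
      (use zero in \<open>auto simp: vcoef_def velocity_def multiplier cis_phase_2pi\<close>)
  then show "v 0 = 0" using a by (simp add: velocity_def)
  have "of_real (a\<^sup>2 / 4) * fcoef u (of_int n + \<kappa>) = 0" for n
    using coefficients(2)[of n] by (simp add: zero)
  then have "fcoef u (of_int n + \<kappa>) = 0" for n :: int
    using a by (simp del: of_real_divide of_real_power)
  then show "u 0 = 0"
    by (rule fcoef_zero_imp_initial_zero[OF c(1) multiplier(1)])
qed

text \<open>At frequency 0 the coefficient is 0 automatically, so one value on each half-line
  determines all.\<close>

lemma periodic_trivial:
  assumes \<kappa>: "\<kappa> = 0" and P1: "vcoef 1 = 0" "vcoef (- 1) = 0"
  shows "u 0 = 0" "v 0 = 0"
proof -
  have P0: "vcoef 0 = 0" using coefficients(1)[of 0] \<kappa> by simp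
  have "vcoef n = 0" for n
  proof (cases "0 \<le> n")
    case True
    show ?thesis
    proof (rule three_term_zero[OF _ _ _ True])
      show "vcoef (k + 1) = rec_coef k * vcoef k - vcoef (k - 1)" if "0 < k" for k
        by (rule recurrence) (use that \<kappa> in simp)
    qed (simp_all add: P0 P1)
  next
    case False
    have "vcoef (- (- n)) = 0"
    proof (rule three_term_zero[of 0 "\<lambda>n. vcoef (- n)" "\<lambda>n. rec_coef (- n)"])
      show "vcoef (- (k + 1)) = rec_coef (- k) * vcoef (- k) - vcoef (- (k - 1))" if "0 < k" for k
        by (rule recurrence_downward) (use that \<kappa> in simp)
    qed (use False in \<open>simp_all add: P0 P1\<close>)
    then show ?thesis by simp
  qed
  then show "u 0 = 0" "v 0 = 0" by (rule vcoef_zero_imp_trivial)+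
qed

text \<open>No frequency \<open>n + 1/2\<close> is 0, so the recurrence runs through all integers
  and two neighbouring values determine everything.\<close>

lemma antiperiodic_trivial:
  assumes \<kappa>: "\<kappa> = 1 / 2" and P01: "vcoef 0 = 0" "vcoef 1 = 0"
  shows "u 0 = 0" "v 0 = 0"
proof -
  have nz: "of_int n + \<kappa> \<noteq> 0" for n :: int
  proof
    assume "of_int n + \<kappa> = 0"
    then have "of_int (2 * n + 1) = (0 :: real)" using \<kappa> by simp
    then have "2 * n + 1 = 0" using of_int_eq_0_iff by blast
    then show False by presburger
  qed
  have "vcoef n = 0" for n
  proof (cases "0 \<le> n")
    case True
    show ?thesis
    proof (rule three_term_zero[OF _ _ _ True])
      show "vcoef (k + 1) = rec_coef k * vcoef k - vcoef (k - 1)" for k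
        by (rule recurrence[OF nz])
    qed (simp_all add: P01)
  next
    case False
    have "vcoef (- (- n)) = 0"
    \<comment> \<open>Starting the reflected sequence at \<open>- 1\<close> gives it the initial
      values \<open>vcoef 1\<close> and \<open>vcoef 0\<close>.\<close>
    proof (rule three_term_zero[of "- 1" "\<lambda>n. vcoef (- n)" "\<lambda>n. rec_coef (- n)"])
      show "vcoef (- (k + 1)) = rec_coef (- k) * vcoef (- k) - vcoef (- (k - 1))" for k
        by (rule recurrence_downward[OF nz])
    qed (use False in \<open>simp_all add: P01\<close>)
    then show ?thesis by simp
  qed
  then show "u 0 = 0" "v 0 = 0" by (rule vcoef_zero_imp_trivial)+
qed

text \<open>\<sigma> selects the half-line on which the diagonal is \<sigma> times
  \<open>jac_diag m a n\<close>; powers of \<open>- \<sigma>\<close> absorb the sign.\<close>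

lemma vcoef_imp_jac_kernel:
  assumes \<kappa>: "\<kappa> = 0" and \<sigma>: "\<sigma> = 1 \<or> \<sigma> = - 1" and l: "of_int \<sigma> * real_of_int l = real m"
    and nz: "vcoef \<sigma> \<noteq> 0"
  shows "(a, s) \<in> jac_kernel m"
proof -
  have \<sigma>2: "- complex_of_int \<sigma> * - of_int \<sigma> = 1" "(of_int \<sigma> :: real) * of_int \<sigma> = 1" using \<sigma> by auto
  have P0: "vcoef 0 = 0" using coefficients(1)[of 0] \<kappa> by simp
  have jac: "complex_of_real (jac m a s n) * vcoef \<sigma> = (- of_int \<sigma>) ^ Suc n * vcoef (\<sigma> * int n)" for n
  proof (induction n rule: induct_nat_012)
    case 1
    then show ?case using \<sigma>2 by simp
  next
    case (ge2 n)
    let ?d = "complex_of_real (2 / s * jac_diag m a (Suc n))"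
    have "vcoef (\<sigma> * int (Suc (Suc n))) = - of_int \<sigma> * ?d * vcoef (\<sigma> * int (Suc n)) - vcoef (\<sigma> * int n)"
    proof -
      have i: "of_int (\<sigma> * int (Suc n)) + \<kappa> + of_int l + a\<^sup>2 / (4 * (of_int (\<sigma> * int (Suc n)) + \<kappa>))
          = of_int \<sigma> * jac_diag m a (Suc n)"
        using \<sigma> l by (elim disjE) (simp_all add: \<kappa> jac_diag_def del: of_nat_Suc)
      have d: "- (2 / s) * (of_int (\<sigma> * int (Suc n)) + \<kappa> + of_int l + a\<^sup>2 / (4 * (of_int (\<sigma> * int (Suc n)) + \<kappa>)))
          = - of_int \<sigma> * (2 / s * jac_diag m a (Suc n))"
        unfolding i by simp
      have h: "vcoef (\<sigma> * int (Suc n) + 1) = - of_int \<sigma> * ?d * vcoef (\<sigma> * int (Suc n)) - vcoef (\<sigma> * int (Suc n) - 1)"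
        using recurrence[of "\<sigma> * int (Suc n)"] \<sigma> unfolding rec_coef_def d by (auto simp: \<kappa>)
      \<comment> \<open>For \<sigma> = - 1 the half-line is traversed downwards, so the recurrence
        is solved for its lower end.\<close>
      have swap: "x = A - y \<Longrightarrow> y = A - x" for x y A :: complex by (simp add: algebra_simps)
      consider "\<sigma> * int (Suc n) + 1 = \<sigma> * int (Suc (Suc n))" "\<sigma> * int (Suc n) - 1 = \<sigma> * int n"
        | "\<sigma> * int (Suc n) - 1 = \<sigma> * int (Suc (Suc n))" "\<sigma> * int (Suc n) + 1 = \<sigma> * int n"
        using \<sigma> by auto
      then show ?thesis
      proof cases
        case 1
        with h show ?thesis by (simp only:)
      next
        case 2
        from swap[OF h] show ?thesis unfolding 2 .
      qed
    qed
    note step = this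
    have pw: "(- of_int \<sigma>) ^ Suc (Suc (Suc n)) = (- complex_of_int \<sigma>) ^ Suc n"
      "(- of_int \<sigma>) ^ Suc (Suc n) = (- complex_of_int \<sigma>) ^ Suc n * - of_int \<sigma>"
      using \<sigma> by auto
    have "complex_of_real (jac m a s (Suc (Suc n))) * vcoef \<sigma>
      = ?d * (complex_of_real (jac m a s (Suc n)) * vcoef \<sigma>) - complex_of_real (jac m a s n) * vcoef \<sigma>"
      by (simp add: algebra_simps)
    moreover have "d * ((w * e) * x) - w * y = w * (e * d * x - y)" for d w e x y :: complex
      by (simp add: algebra_simps)
    ultimately show ?case
      unfolding ge2.IH step pw by (simp only:)
  qed (simp add: P0)
  obtain B where B: "\<And>n. norm (vcoef n) \<le> B" using vcoef_bounded by blast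
  have "norm (jac m a s n) \<le> B / norm (vcoef \<sigma>)" for n
  proof -
    have "norm (jac m a s n) * norm (vcoef \<sigma>) = norm (vcoef (\<sigma> * int n))"
      using arg_cong[OF jac[of n], of norm] \<sigma> by (auto simp: norm_mult norm_power)
    then show ?thesis using B[of "\<sigma> * int n"] nz by (simp add: field_simps)
  qed
  then have "Bseq (jac m a s)" by (rule BseqI')
  with s show ?thesis by (simp add: jac_kernel_def)
qed

end

text \<open>The hypothesis is a vanishing determinant; it turns a zero Casoratian into a nonzero
  combination with zero initial data.\<close>

lemma linear_dependent_pair:
  fixes x y z w :: complex
  assumes "x * w = y * z"
  obtains c d where "c \<noteq> 0 \<or> d \<noteq> 0" "c * x + d * z = 0" "c * y + d * w = 0"
proof (cases "x = 0 \<and> z = 0")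
  case True
  show ?thesis
  proof (cases "y = 0 \<and> w = 0")
    case True
    with \<open>x = 0 \<and> z = 0\<close> that[of 1 0] show ?thesis by simp
  next
    case False
    with \<open>x = 0 \<and> z = 0\<close> that[of w "- y"] show ?thesis by (auto simp: algebra_simps)
  qed
next
  case False
  with assms that[of z "- x"] show ?thesis by (auto simp: algebra_simps)
qed

text \<open>An antiperiodic fundamental system would give two independent solutions of the two-sided
  recurrence that decay at \<open>+\<infinity>\<close>; their Casoratian is constant, hence zero.\<close>

lemma Constr_subset_jac_kernel:
  assumes C: "(a, s) \<in> Constr l"
  shows "(a, s) \<in> jac_kernel (nat \<bar>l\<bar>)"
proof -
  have a: "0 < a" and s: "0 < s" using C by (auto simp: Constr_def)
  obtain \<mu> u1 v1 u2 v2 where \<mu>: "\<mu> = 1 \<or> \<mu> = - 1"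
    and 1: "josephson_linear l a s u1 v1" "u1 0 = 1" "v1 0 = 1" "u1 (2*pi) = \<mu>" "v1 (2*pi) = \<mu>"
    and 2: "josephson_linear l a s u2 v2" "u2 0 = - 1" "v2 0 = 1" "u2 (2*pi) = - \<mu>" "v2 (2*pi) = \<mu>"
    by (rule Constr_fundamental_solutions[OF C])
  define \<kappa> :: real where "\<kappa> = (if \<mu> = 1 then 0 else 1 / 2)"
  have \<kappa>: "cis (2 * pi * \<kappa>) = \<mu>" using \<mu> by (auto simp: \<kappa>_def)
  let ?u = "\<lambda>c d t. c * u1 t + d * u2 t" and ?v = "\<lambda>c d t. c * v1 t + d * v2 t"
  have modes: "josephson_modes a s l \<kappa> (?u c d) (?v c d)" for c d
  proof
    show "?u c d (2*pi) = cis (2*pi*\<kappa>) * ?u c d 0" "?v c d (2*pi) = cis (2*pi*\<kappa>) * ?v c d 0"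
      unfolding \<kappa> 1 2 by (simp_all add: algebra_simps)
  qed (intro a s josephson_linear_combination 1 2)+
  have modes1: "josephson_modes a s l \<kappa> u1 v1" and modes2: "josephson_modes a s l \<kappa> u2 v2"
    by (unfold_locales; auto intro!: a s 1 2 simp: \<kappa> 1 2)+
  interpret M1: josephson_modes a s l \<kappa> u1 v1 by (rule modes1)
  interpret M2: josephson_modes a s l \<kappa> u2 v2 by (rule modes2)
  have comb: "josephson_modes.vcoef a s l \<kappa> (?v c d) n = c * M1.vcoef n + d * M2.vcoef n" for c d n
    unfolding josephson_modes.vcoef_def[OF modes] M1.vcoef_def M2.vcoef_def velocity_linear_combination
    by (rule fcoef_linear_combination) (rule josephson_linear_continuous(3)[OF 1(1)] josephson_linear_continuous(3)[OF 2(1)])+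
  have nontriv: "c = 0 \<and> d = 0" if "?u c d 0 = 0" "?v c d 0 = 0" for c d
    using that by (auto simp: 1 2)
  show ?thesis
  proof (cases "\<mu> = 1")
    case True
    then have \<kappa>0: "\<kappa> = 0" by (simp add: \<kappa>_def)
    define \<sigma> :: int where "\<sigma> = (if 0 \<le> l then 1 else - 1)"
    have \<sigma>: "\<sigma> = 1 \<or> \<sigma> = - 1" "of_int \<sigma> * real_of_int l = real (nat \<bar>l\<bar>)" by (auto simp: \<sigma>_def)
    \<comment> \<open>If both vanished at \<sigma>, a nonzero combination would vanish at
      \<open>- \<sigma>\<close> as well and be trivial, against the independence of the two
      solutions.\<close>
    have "M1.vcoef \<sigma> \<noteq> 0 \<or> M2.vcoef \<sigma> \<noteq> 0"
    proof (rule ccontr)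
      assume z: "\<not> (M1.vcoef \<sigma> \<noteq> 0 \<or> M2.vcoef \<sigma> \<noteq> 0)"
      obtain c d where cd: "c \<noteq> 0 \<or> d \<noteq> 0" "c * M1.vcoef \<sigma> + d * M2.vcoef \<sigma> = 0" "c * M1.vcoef (- \<sigma>) + d * M2.vcoef (- \<sigma>) = 0"
        using linear_dependent_pair[of "M1.vcoef \<sigma>" "M2.vcoef (- \<sigma>)" "M1.vcoef (- \<sigma>)" "M2.vcoef \<sigma>"] z by auto
      then have "josephson_modes.vcoef a s l \<kappa> (?v c d) 1 = 0" "josephson_modes.vcoef a s l \<kappa> (?v c d) (- 1) = 0"
        using \<sigma>(1) by (auto simp: comb)
      from josephson_modes.periodic_trivial[OF modes \<kappa>0 this] nontriv cd(1) show False by blast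
    qed
    then show ?thesis
      using M1.vcoef_imp_jac_kernel[OF \<kappa>0 \<sigma>] M2.vcoef_imp_jac_kernel[OF \<kappa>0 \<sigma>] by blast
  next
    case False
    then have \<kappa>h: "\<kappa> = 1 / 2" by (simp add: \<kappa>_def)
    define W where "W n = M1.vcoef (int n) * M2.vcoef (int (Suc n)) - M1.vcoef (int (Suc n)) * M2.vcoef (int n)" for n
    have const: "W n = W 0" for n
    proof (induction n)
      case (Suc n)
      have nz: "of_int (int (Suc n)) + \<kappa> \<noteq> 0" by (simp add: \<kappa>h)
      have i: "int (Suc n) + 1 = int (Suc (Suc n))" "int (Suc n) - 1 = int n" by auto
      have "x * (c * y - y0) - (c * x - x0) * y = x0 * y - x * y0" for x y x0 y0 c :: complex
        by (simp add: algebra_simps)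
      then have "W (Suc n) = W n"
        unfolding W_def M1.recurrence[OF nz, unfolded i] M2.recurrence[OF nz, unfolded i] .
      then show ?case using Suc.IH by simp
    qed simp
    have "W \<longlonglongrightarrow> 0"
    proof -
      obtain B1 where B1: "\<And>n. \<bar>of_int n + \<kappa>\<bar> * norm (M1.vcoef n) \<le> B1" using M1.vcoef_decay by blast
      obtain B2 where B2: "\<And>n. norm (M2.vcoef n) \<le> B2" using M2.vcoef_bounded by blast
      \<comment> \<open>One factor of each product decays like 1/n while the other stays bounded;
        \<open>n \<le> k\<close> covers both indices occurring in \<open>W n\<close>.\<close>
      have P1: "norm (M1.vcoef (int k)) \<le> 2 * B1 * inverse (real (Suc n))" if "n \<le> k" for k n
      proof -
        have "real (Suc n) / 2 * norm (M1.vcoef (int k)) \<le> \<bar>of_int (int k) + \<kappa>\<bar> * norm (M1.vcoef (int k))"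
          using that by (intro mult_right_mono) (auto simp: \<kappa>h)
        with B1[of "int k"] show ?thesis by (simp add: field_simps)
      qed
      have le: "norm (W n) \<le> (2 * B1 * B2 + 2 * B1 * B2) * inverse (real (Suc n))" for n
      proof -
        have "norm (W n) \<le> norm (M1.vcoef (int n)) * norm (M2.vcoef (int (Suc n))) + norm (M1.vcoef (int (Suc n))) * norm (M2.vcoef (int n))"
          unfolding W_def norm_mult[symmetric] by (rule norm_triangle_ineq4)
        also have "\<dots> \<le> 2 * B1 * inverse (real (Suc n)) * B2 + 2 * B1 * inverse (real (Suc n)) * B2"
          by (intro add_mono mult_mono P1 B2 order_trans[OF norm_ge_zero P1]) auto
        finally show ?thesis by (simp add: algebra_simps)
      qed
      have lim: "(\<lambda>n. (2 * B1 * B2 + 2 * B1 * B2) * inverse (real (Suc n))) \<longlonglongrightarrow> 0"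
        by (rule tendsto_mult_right_zero[OF LIMSEQ_inverse_real_of_nat])
      show ?thesis
        by (rule Lim_null_comparison[OF _ lim]) (use le in simp)
    qed
    moreover have "W = (\<lambda>_. W 0)" using const by (rule ext)
    ultimately have "W 0 = 0" by (metis LIMSEQ_const_iff)
    then obtain c d where cd: "c \<noteq> 0 \<or> d \<noteq> 0" "c * M1.vcoef 0 + d * M2.vcoef 0 = 0" "c * M1.vcoef 1 + d * M2.vcoef 1 = 0"
      using linear_dependent_pair[of "M1.vcoef 0" "M2.vcoef 1" "M1.vcoef 1" "M2.vcoef 0"] by (auto simp: W_def)
    then have "josephson_modes.vcoef a s l \<kappa> (?v c d) 0 = 0" "josephson_modes.vcoef a s l \<kappa> (?v c d) 1 = 0"
      by (simp_all only: comb)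
    from josephson_modes.antiperiodic_trivial[OF modes \<kappa>h this] nontriv cd(1) show ?thesis by blast
  qed
qed

subsection \<open>Landing of the constriction curves\<close>

lemma dist_pair_le: "dist (a, s) (b, t) \<le> \<bar>a - b\<bar> + \<bar>s - t\<bar>" for a b s t :: real
  unfolding dist_Pair_Pair dist_real_def by (rule order_trans[OF sqrt_sum_squares_le_sum_abs]) simp

text \<open>Infinitely many zeros would accumulate at some \<open>p \<ge> 1 / 2\<close>, again a
  kernel point at \<open>a = 0\<close>; \<open>jac_kernel_monotone\<close> with equal first
  coordinates makes it isolated.\<close>

lemma finite_Bessel_zeros: "finite {y. 0 < y \<and> y \<le> x \<and> Bessel_J l y = 0}"
proof (rule ccontr)
  define m where "m = nat \<bar>l\<bar>"
  let ?Z = "{y. 0 < y \<and> y \<le> x \<and> Bessel_J l y = 0}"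
  have Z: "(0, y) \<in> jac_kernel m" if "y \<in> ?Z" for y
    using that Bessel_J_eq_0_iff[of y l] by (simp add: m_def jac_kernel_0_iff)
  have "?Z \<subseteq> {1 / 2..x}"
    using jac_kernel_gt_half[OF Z] by (force intro: less_imp_le)
  moreover assume "infinite ?Z"
  ultimately obtain p where p: "p \<in> {1 / 2..x}" "p islimpt ?Z"
    using compact_eq_Bolzano_Weierstrass[of "{1 / 2..x}"] by auto
  have near: "\<exists>y\<in>?Z. y \<noteq> p \<and> dist (0, y) (0 :: real, p) < d" if "0 < d" for d
    using p(2) that unfolding islimpt_approachable by (simp add: dist_Pair_Pair)
  have "(0, p) \<in> closure (jac_kernel m)"
    unfolding closure_approachable using near Z by blast
  then have K: "(0, p) \<in> jac_kernel m"
    using jac_kernel_closed p(1) by fastforce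
  from jac_kernel_monotone[OF K] obtain d where d: "d > 0" "\<And>a s b t. (a, s) \<in> jac_kernel m \<Longrightarrow> (b, t) \<in> jac_kernel m \<Longrightarrow>
    dist (a, s) (0, p) < d \<Longrightarrow> dist (b, t) (0, p) < d \<Longrightarrow> 0 \<le> a \<Longrightarrow> a \<le> b \<Longrightarrow> t \<le> s \<Longrightarrow> a = b \<and> s = t"
    by blast
  obtain y where y: "y \<in> ?Z" "y \<noteq> p" "dist (0, y) (0 :: real, p) < d" using near[OF d(1)] by blast
  show False
    using d(2)[OF Z[OF y(1)] K] d(2)[OF K Z[OF y(1)]] y d(1) by (cases "y \<le> p") auto
qed

text \<open>The count strictly increases from one zero to a larger one, so the description of the
  \<open>k\<close>-th zero is unique.\<close>

lemma Bessel_zero_card: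
  assumes "0 < x" "Bessel_J l x = 0"
  shows "Bessel_zero l (card {y. 0 < y \<and> y \<le> x \<and> Bessel_J l y = 0}) = x"
  unfolding Bessel_zero_def
proof (rule the_equality)
  fix z assume z: "0 < z \<and> Bessel_J l z = 0 \<and>
    card {y. 0 < y \<and> y \<le> z \<and> Bessel_J l y = 0} = card {y. 0 < y \<and> y \<le> x \<and> Bessel_J l y = 0}"
  have "card {y. 0 < y \<and> y \<le> u \<and> Bessel_J l y = 0} < card {y. 0 < y \<and> y \<le> w \<and> Bessel_J l y = 0}"
    if "u < w" "0 < w" "Bessel_J l w = 0" for u w
  proof (rule psubset_card_mono[OF finite_Bessel_zeros])
    have "w \<in> {y. 0 < y \<and> y \<le> w \<and> Bessel_J l y = 0} - {y. 0 < y \<and> y \<le> u \<and> Bessel_J l y = 0}"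
      using that by simp
    moreover have "{y. 0 < y \<and> y \<le> u \<and> Bessel_J l y = 0} \<subseteq> {y. 0 < y \<and> y \<le> w \<and> Bessel_J l y = 0}"
      using that(1) by auto
    ultimately show "{y. 0 < y \<and> y \<le> u \<and> Bessel_J l y = 0} \<subset> {y. 0 < y \<and> y \<le> w \<and> Bessel_J l y = 0}"
      by blast
  qed
  from this[of z x] this[of x z] show "z = x" using z assms by force
qed (use assms in simp)

section \<open>Constriction curves as increasing graphs\<close>

lemma real_analytic_on_imp_isCont:
  assumes "real_analytic_on f S" "x \<in> S"
  shows "isCont f x"
proof -
  obtain c :: "nat \<Rightarrow> real" and r where r: "r > 0"
    and f: "\<And>y. \<bar>y - x\<bar> < r \<Longrightarrow> (\<lambda>n. c n * (y - x) ^ n) sums f y"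
    using assms unfolding real_analytic_on_def by blast
  have "(\<lambda>h. f (x + h)) \<midarrow>0\<rightarrow> c 0"
  proof (rule powser_limit_0[OF r])
    fix h :: real assume "norm h < r"
    then show "(\<lambda>n. c n * h ^ n) sums f (x + h)" using f[of "x + h"] by simp
  qed
  moreover have "c 0 = f x"
    using f[of x] r sums_unique2[OF powser_sums_zero] by fastforce
  ultimately show ?thesis by (simp add: isCont_iff)
qed

lemma projected_component_graph:
  assumes C: "C \<in> components (Constr l)" and proj: "bijectively_analytically_projected C"
  obtains g where "C = {(a, g a) | a. 0 < a}" "\<And>a. 0 < a \<Longrightarrow> isCont g a"
    "\<And>a. 0 < a \<Longrightarrow> (a, g a) \<in> jac_kernel (nat \<bar>l\<bar>)"
proof
  define g where "g a = snd (inv_into C fst a)" for a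
  have bij: "bij_betw fst C {0<..}" and an: "real_analytic_on g {0<..}"
    using proj by (simp_all add: bijectively_analytically_projected_def g_def[abs_def])
  have inv: "inv_into C fst a = (a, g a)" if "0 < a" for a
    using bij_betw_inv_into_right[OF bij, of a] that by (simp add: g_def prod_eq_iff)
  show CC: "C = {(a, g a) | a. 0 < a}"
  proof (intro equalityI subsetI)
    fix p assume p: "p \<in> C"
    then have "0 < fst p" using bij by (force simp: bij_betw_def)
    then show "p \<in> {(a, g a) | a. 0 < a}"
      using bij_betw_inv_into_left[OF bij p] inv[of "fst p"] by force
  next
    fix p assume "p \<in> {(a, g a) | a. 0 < a}"
    then obtain a where "p = inv_into C fst a" "0 < a" using inv by auto
    then show "p \<in> C" using bij by (metis bij_betw_def greaterThan_iff inv_into_into)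
  qed
  show "isCont g a" if "0 < a" for a
    by (rule real_analytic_on_imp_isCont[OF an]) (use that in simp)
  show "(a, g a) \<in> jac_kernel (nat \<bar>l\<bar>)" if "0 < a" for a
    using in_components_subset[OF C] that CC Constr_subset_jac_kernel by blast
qed

text \<open>A maximum on the interval must sit at its right end: at an earlier point, local
  monotonicity excludes nearby later points with a value no larger.\<close>

lemma kernel_graph_increasing:
  assumes cont: "\<And>a. 0 < a \<Longrightarrow> isCont g a"
    and ker: "\<And>a. 0 < a \<Longrightarrow> (a, g a) \<in> jac_kernel m"
    and xy: "0 < x" "x \<le> y"
  shows "g x \<le> g y"
proof -
  have "continuous_on {x..y} g"
    using cont xy by (intro continuous_at_imp_continuous_on) auto
  then obtain c where c: "c \<in> {x..y}" "\<And>t. t \<in> {x..y} \<Longrightarrow> g t \<le> g c"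
    using continuous_attains_sup[of "{x..y}" g] xy by auto
  have c0: "0 < c" using c xy by auto
  have "c = y"
  proof (rule ccontr)
    assume "c \<noteq> y"
    then have "c < y" using c by auto
    obtain d where d: "d > 0" "\<And>a s b t. (a, s) \<in> jac_kernel m \<Longrightarrow> (b, t) \<in> jac_kernel m \<Longrightarrow>
      dist (a, s) (c, g c) < d \<Longrightarrow> dist (b, t) (c, g c) < d \<Longrightarrow> 0 \<le> a \<Longrightarrow> a \<le> b \<Longrightarrow> t \<le> s \<Longrightarrow> a = b \<and> s = t"
      using jac_kernel_monotone[OF ker[OF c0]] by blast
    obtain e where e: "e > 0" "\<And>t. dist t c < e \<Longrightarrow> dist (g t) (g c) < d / 2"
      using cont[OF c0] d(1) unfolding continuous_at_eps_delta by (meson half_gt_zero)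
    define t where "t = c + min (y - c) (min (e / 2) (d / 3))"
    have t: "c < t" "t \<le> y" "t - c < e" "t - c < d / 2"
      using \<open>c < y\<close> e(1) d(1) unfolding t_def by linarith+
    have "dist (t, g t) (c, g c) \<le> \<bar>t - c\<bar> + \<bar>g t - g c\<bar>" by (rule dist_pair_le)
    also have "\<dots> < d" using e(2)[of t] t by (simp add: dist_real_def)
    finally have "dist (t, g t) (c, g c) < d" .
    moreover have "g t \<le> g c" using c t by auto
    ultimately have "c = t"
      using d(2)[OF ker[OF c0] ker, of t] d(1) t c0 by simp
    with t show False by simp
  qed
  then show ?thesis using c xy by auto
qed

text \<open>An increasing function tends to its infimum at the left end; the bound 1/2 keeps this
  infimum positive.\<close>

lemma kernel_graph_landing:
  assumes cont: "\<And>a. 0 < a \<Longrightarrow> isCont g a"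
    and ker: "\<And>a. 0 < a \<Longrightarrow> (a, g a) \<in> jac_kernel m"
  obtains s where "0 < s" "(g \<longlongrightarrow> s) (at_right 0)"
proof -
  define s where "s = Inf (g ` {0<..})"
  have half: "1 / 2 \<le> g a" if "0 < a" for a
    using jac_kernel_gt_half[OF ker[OF that]] by simp
  have bdd: "bdd_below (g ` {0<..})" using half by (auto intro!: bdd_belowI[of _ "1 / 2"])
  have "1 / 2 \<le> s" unfolding s_def using half by (intro cInf_greatest) auto
  moreover have "(g \<longlongrightarrow> s) (at_right 0)"
  proof (rule order_tendstoI)
    fix c assume "c < s"
    have "c < g a" if "0 < a" for a
      using cInf_lower[OF _ bdd, of "g a"] that \<open>c < s\<close> by (force simp: s_def)
    then show "\<forall>\<^sub>F a in at_right 0. c < g a" by (auto simp: eventually_at_filter)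
  next
    fix c assume "s < c"
    then obtain b where b: "0 < b" "g b < c"
      using cInf_lessD[of "g ` {0<..}" c] by (auto simp: s_def)
    have "g a < c" if "0 < a" "a < b" for a
      using kernel_graph_increasing[OF cont ker, of a b] that b by fastforce
    then show "\<forall>\<^sub>F a in at_right 0. g a < c"
      using b(1) by (auto simp: eventually_at_right_field)
  qed
  ultimately show thesis using that[of s] by simp
qed

theorem corollary1p19:
  assumes "\<forall>l::int. \<forall>C\<in>components (Constr l). bijectively_analytically_projected C"
  shows "\<forall>l::int. \<forall>C\<in>components (Constr l).
           \<exists>k::nat. k \<ge> 1 \<and> beta_pt l k \<in> closure C \<and> C = constr_curve l k"
proof (intro allI ballI)
  fix l :: int and C assume C: "C \<in> components (Constr l)"
  have proj: "bijectively_analytically_projected D" if "D \<in> components (Constr l)" for D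
    using assms that by blast
  define m where "m = nat \<bar>l\<bar>"
  obtain g where g: "C = {(a, g a) | a. 0 < a}" "\<And>a. 0 < a \<Longrightarrow> isCont g a"
    "\<And>a. 0 < a \<Longrightarrow> (a, g a) \<in> jac_kernel m"
    using projected_component_graph[OF C proj[OF C], folded m_def, of thesis] by blast
  obtain s where s: "0 < s" "(g \<longlongrightarrow> s) (at_right 0)"
    by (rule kernel_graph_landing[OF g(2,3)])
  have near: "\<exists>b>0. \<forall>a. 0 < a \<and> a < b \<longrightarrow> dist (a, g a) (0, s) < e" if "0 < e" for e
  proof -
    have "\<forall>\<^sub>F a in at_right 0. dist (g a) s < e / 2"
      using tendstoD[OF s(2), of "e / 2"] that by simp
    then obtain b where b: "b > 0" "\<And>a. 0 < a \<Longrightarrow> a < b \<Longrightarrow> dist (g a) s < e / 2"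
      by (auto simp: eventually_at_right_field)
    have "dist (a, g a) (0, s) < e" if "0 < a" "a < min b (e / 2)" for a
      using dist_pair_le[of a "g a" 0 s] b(2)[of a] that by (simp add: dist_real_def)
    then show ?thesis using b(1) that by (intro exI[of _ "min b (e / 2)"]) auto
  qed
  have clC: "(0, s) \<in> closure C"
    unfolding closure_approachable
  proof (intro allI impI)
    fix e :: real assume "0 < e"
    then obtain b where b: "b > 0" "\<And>a. 0 < a \<Longrightarrow> a < b \<Longrightarrow> dist (a, g a) (0, s) < e" using near by blast
    have "(b / 2, g (b / 2)) \<in> C" unfolding g(1) using half_gt_zero[OF b(1)] by blast
    then show "\<exists>y\<in>C. dist y (0, s) < e"
      using b by (intro bexI[of _ "(b / 2, g (b / 2))"]) auto
  qed
  have "C \<subseteq> jac_kernel m" using g(1,3) by auto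
  \<comment> \<open>The kernel set is closed where the second coordinate is positive, so the limit
    point on \<open>a = 0\<close> lies in it and gives a Bessel zero.\<close>
  then have K: "(0, s) \<in> jac_kernel m"
    using jac_kernel_closed[of "(0, s)" m] closure_mono[of C "jac_kernel m"] clC s(1) by auto
  then have zero: "Bessel_J l s = 0"
    using s(1) Bessel_J_eq_0_iff[OF s(1), of l] by (simp add: m_def jac_kernel_0_iff)
  define k where "k = card {y. 0 < y \<and> y \<le> s \<and> Bessel_J l y = 0}"
  have beta: "beta_pt l k = (0, s)"
    unfolding beta_pt_def k_def by (simp add: Bessel_zero_card[OF s(1) zero])
  have "k \<ge> 1"
  proof -
    have "card {s} \<le> k"
      unfolding k_def by (rule card_mono[OF finite_Bessel_zeros]) (use s(1) zero in simp)
    then show ?thesis by simp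
  qed
  moreover have "constr_curve l k = C"
    unfolding constr_curve_def beta
  proof (rule the_equality)
    \<comment> \<open>Another curve landing at \<open>(0, s)\<close> agrees with \<open>C\<close> at
      some common \<open>a\<close>, by \<open>jac_kernel_monotone\<close> with equal first
      coordinates; components that meet coincide.\<close>
    fix D assume D: "D \<in> components (Constr l) \<and> (0, s) \<in> closure D"
    obtain h where h: "D = {(a, h a) | a. 0 < a}" "\<And>a. 0 < a \<Longrightarrow> (a, h a) \<in> jac_kernel m"
      using projected_component_graph[OF conjunct1[OF D] proj[OF conjunct1[OF D]], folded m_def, of thesis] by blast
    obtain d where d: "d > 0" "\<And>a s' b t. (a, s') \<in> jac_kernel m \<Longrightarrow> (b, t) \<in> jac_kernel m \<Longrightarrow>
      dist (a, s') (0, s) < d \<Longrightarrow> dist (b, t) (0, s) < d \<Longrightarrow> 0 \<le> a \<Longrightarrow> a \<le> b \<Longrightarrow> t \<le> s' \<Longrightarrow> a = b \<and> s' = t"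
      using jac_kernel_monotone[OF K] by blast
    obtain b where b: "b > 0" "\<And>a. 0 < a \<Longrightarrow> a < b \<Longrightarrow> dist (a, g a) (0, s) < d" using near[OF d(1)] by blast
    \<comment> \<open>Distance below \<open>b\<close> forces \<open>a < b\<close>, where the graph
      of \<open>g\<close> is near \<open>(0, s)\<close>; distance below \<open>d\<close> does the
      same for the point of \<open>D\<close>.\<close>
    have "0 < min b d" using b(1) d(1) by simp
    then obtain q where "q \<in> D" "dist q (0, s) < min b d"
      using D unfolding closure_approachable by blast
    then obtain a where a: "0 < a" "dist (a, h a) (0, s) < b" "dist (a, h a) (0, s) < d"
      unfolding h(1) by auto
    have "a < b" using dist_fst_le[of "(a, h a)" "(0, s)"] a by (simp add: dist_real_def)
    then have "g a = h a"
      using d(2)[OF g(3) h(2), of a a] d(2)[OF h(2) g(3), of a a] b(2)[of a] a by (cases "h a \<le> g a") auto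
    then have "(a, g a) \<in> C \<inter> D" using a(1) unfolding g(1) h(1) by auto
    then show "D = C" using components_nonoverlap[OF C] D by blast
  qed (use C clC in simp)
  ultimately show "\<exists>k::nat. k \<ge> 1 \<and> beta_pt l k \<in> closure C \<and> C = constr_curve l k"
    using beta clC by auto
qed

end
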